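(* Let $c_L,h,h_W\in\mathbb{C}$, $c_W\in\mathbb{C}\setminus\{0\}$, and assume that $\frac{h_W}{c_W}=\frac{1-p^2}{24}$ with $p\in\mathbb{Z}_{>0}$. Let $h_I,c_{L,I}\in\mathbb{C}$ be such that $$c_W=-24c_{L,I}^2,\qquad h_W=h_I(h_I-2c_{L,I}),\qquad\frac{h_I}{c_{L,I}}-1=p.$$ Let $\Psi:V^{W(2,2)}(c_L,c_W,h,h_W)\to V^{\mathcal H}(c_L,0,c_{L,I},h,h_I)$ be the $W(2,2)$-homomorphism with $\Psi(v_{h,h_W})=v_{h,h_I}$ (which is an isomorphism in this case). Then $$\Psi^{-1}\left(S_p\left(-\frac{I(-1)}{c_{L,I}},-\frac{I(-2)}{c_{L,I}},\dots\right)v_{h,h_I}\right)$$ is a singular vector of conformal weight $p$ in the Verma module $V^{W(2,2)}(c_L,c_W,h,h_W)$.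
   Context: The twisted Heisenberg-Virasoro algebra $\mathcal H$ is the complex Lie algebra with basis $\{L(n),I(n):n\in\mathbb{Z}\}\cup\{C_L,C_{LI},C_I\}$ and brackets $[L(n),L(m)]=(n-m)L(n+m)+\delta_{n,-m}\frac{n^3-n}{12}C_L$, $[L(n),I(m)]=-mI(n+m)-\delta_{n,-m}(n^2+n)C_{LI}$, $[I(n),I(m)]=n\delta_{n,-m}C_I$, with $C_L,C_{LI},C_I$ central. $V^{\mathcal H}(c_L,0,c_{L,I},h,h_I)$ is the Verma module with highest weight vector $v_{h,h_I}$ (annihilated by $L(n),I(n)$, $n>0$; $L(0),I(0)$ act on it by $h,h_I$; $C_L,C_I,C_{LI}$ act as $c_L,0,c_{L,I}$), free over $U(\mathrm{span}\{L(-n),I(-n):n\ge1\})$. The Lie algebra $W(2,2)$ has basis $\{W(n),L(n),C,C_W:n\in\mathbb{Z}\}$, with $[L(n),L(m)]=(n-m)L(n+m)+\delta_{n,-m}\frac{n^3-n}{12}C$, $[L(n),W(m)]=(n-m)W(n+m)+\delta_{n,-m}\frac{n^3-n}{12}C_W$, $[W(n),W(m)]=0$, and $C,C_W$ central. $V^{W(2,2)}(c_L,c_W,h,h_W)$ is its Verma module with highest weight vector $v_{h,h_W}$ (annihilated by $L(n),W(n)$, $n>0$; $L(0),W(0)$ act on it by $h,h_W$; $C,C_W$ act as $c_L,c_W$). A singular vector of conformal weight $p$ in it is a nonzero vector annihilated by all $L(n),W(n)$, $n>0$, and lying in the $L(0)$-eigenspace of eigenvalue $h+p$. $V^{\mathcal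 H}(c_L,0,c_{L,I},h,h_I)$ is a $W(2,2)$-module with $L(n)$ acting as before, $C,C_W$ acting as $c_L,c_W$, and $W(n)$ the components of $W(z)=\sum_nW(n)z^{-n-2}=\,:I(z)^2:+2c_{L,I}\frac{d}{dz}I(z)$, where $I(z)=\sum_nI(n)z^{-n-1}$; then $W(0)v_{h,h_I}=h_I(h_I-2c_{L,I})v_{h,h_I}$. Schur polynomials: $\exp\left(\sum_{n\ge1}\frac{x_n}{n}y^n\right)=\sum_{r\ge0}S_r(x_1,x_2,\dots)y^r$. *)

theory Defs
  imports
    Complex_Main
    "HOL-Library.Poly_Mapping"
    "HOL-Computational_Algebra.Formal_Power_Series"
begin

section \<open>Lie algebras given by a basis, and their modules\<close>

text \<open>
  A complex Lie algebra is given by a type \<open>'g\<close> of basis elements and its bracket on basis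
  elements, with values in the free vector space \<open>'g \<Rightarrow>\<^sub>0 complex\<close>. A module is a complex vector
  space (a whole type \<open>'v\<close> with scalar multiplication \<open>scale\<close>) with one operator per basis element.
\<close>

definition lie_module ::
  "('g \<Rightarrow> 'g \<Rightarrow> ('g \<Rightarrow>\<^sub>0 complex)) \<Rightarrow> (complex \<Rightarrow> 'v \<Rightarrow> 'v::ab_group_add) \<Rightarrow> ('g \<Rightarrow> 'v \<Rightarrow> 'v) \<Rightarrow> bool"
where
  "lie_module br scale \<rho> \<longleftrightarrow>
     vector_space scale \<and>
     (\<forall>x. Vector_Spaces.linear scale scale (\<rho> x)) \<and>
     (\<forall>x y u. \<rho> x (\<rho> y u) - \<rho> y (\<rho> x u) =
        (\<Sum>z\<in>Poly_Mapping.keys (br x y). scale (Poly_Mapping.lookup (br x y) z) (\<rho> z u)))"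

definition lie_module_hom ::
  "(complex \<Rightarrow> 'v \<Rightarrow> 'v::ab_group_add) \<Rightarrow> (complex \<Rightarrow> 'w \<Rightarrow> 'w::ab_group_add) \<Rightarrow>
   ('g \<Rightarrow> 'v \<Rightarrow> 'v) \<Rightarrow> ('g \<Rightarrow> 'w \<Rightarrow> 'w) \<Rightarrow> ('v \<Rightarrow> 'w) \<Rightarrow> bool"
where
  "lie_module_hom scale1 scale2 \<rho>1 \<rho>2 f \<longleftrightarrow>
     Vector_Spaces.linear scale1 scale2 f \<and> (\<forall>x u. f (\<rho>1 x u) = \<rho>2 x (f u))"


section \<open>Universal enveloping algebras and free modules of rank one\<close>

text \<open>
  Let \<open>S\<close> be a set of basis elements spanning a Lie subalgebra. Its tensor algebra \<open>T(S)\<close> has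
  the words over \<open>S\<close> as a basis, and \<open>U(S) = T(S)/J(S)\<close>, where \<open>J(S)\<close> is the two-sided ideal
  generated by all \<open>x \<otimes> y - y \<otimes> x - [x, y]\<close>. As words span \<open>T(S)\<close>, the ideal is the linear span of
  the generators multiplied by words on both sides.
\<close>

definition tensor_scale :: "complex \<Rightarrow> ('g list \<Rightarrow>\<^sub>0 complex) \<Rightarrow> ('g list \<Rightarrow>\<^sub>0 complex)" where
  "tensor_scale c a = Poly_Mapping.map ((*) c) a"

definition tensor_algebra :: "'g set \<Rightarrow> ('g list \<Rightarrow>\<^sub>0 complex) set" where
  "tensor_algebra S = {a. Poly_Mapping.keys a \<subseteq> lists S}"

definition uea_relator ::
  "('g \<Rightarrow> 'g \<Rightarrow> ('g \<Rightarrow>\<^sub>0 complex)) \<Rightarrow> 'g list \<Rightarrow> 'g \<Rightarrow> 'g \<Rightarrow> 'g list \<Rightarrow> ('g list \<Rightarrow>\<^sub>0 complex)"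
where
  "uea_relator br s x y t =
     Poly_Mapping.single (s @ [x, y] @ t) 1 - Poly_Mapping.single (s @ [y, x] @ t) 1 -
     (\<Sum>z\<in>Poly_Mapping.keys (br x y).
        Poly_Mapping.single (s @ [z] @ t) (Poly_Mapping.lookup (br x y) z))"

definition uea_ideal :: "('g \<Rightarrow> 'g \<Rightarrow> ('g \<Rightarrow>\<^sub>0 complex)) \<Rightarrow> 'g set \<Rightarrow> ('g list \<Rightarrow>\<^sub>0 complex) set" where
  "uea_ideal br S = module.span tensor_scale
     {uea_relator br s x y t | s x y t. s \<in> lists S \<and> x \<in> S \<and> y \<in> S \<and> t \<in> lists S}"

definition tensor_act ::
  "(complex \<Rightarrow> 'v \<Rightarrow> 'v::ab_group_add) \<Rightarrow> ('g \<Rightarrow> 'v \<Rightarrow> 'v) \<Rightarrow> ('g list \<Rightarrow>\<^sub>0 complex) \<Rightarrow> 'v \<Rightarrow> 'v"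
where
  "tensor_act scale \<rho> a u =
     (\<Sum>w\<in>Poly_Mapping.keys a. scale (Poly_Mapping.lookup a w) (foldr \<rho> w u))"

text \<open>
  The module is free of rank one over \<open>U(S)\<close> with generator \<open>v\<close>, that is, the map
  \<open>U(S) \<rightarrow> V\<close>, \<open>a \<mapsto> a v\<close>, is bijective: \<open>T(S) \<rightarrow> V\<close> is onto and its kernel is \<open>J(S)\<close>.
\<close>

definition free_over_uea ::
  "('g \<Rightarrow> 'g \<Rightarrow> ('g \<Rightarrow>\<^sub>0 complex)) \<Rightarrow> (complex \<Rightarrow> 'v \<Rightarrow> 'v::ab_group_add) \<Rightarrow> ('g \<Rightarrow> 'v \<Rightarrow> 'v) \<Rightarrow>
   'g set \<Rightarrow> 'v \<Rightarrow> bool"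
where
  "free_over_uea br scale \<rho> S v \<longleftrightarrow>
     (\<lambda>a. tensor_act scale \<rho> a v) ` tensor_algebra S = UNIV \<and>
     {a \<in> tensor_algebra S. tensor_act scale \<rho> a v = 0} = uea_ideal br S"


section \<open>The twisted Heisenberg-Virasoro algebra and its Verma modules\<close>

datatype hv_basis = LH int | IH int | CLH | CLIH | CIH

fun hv_bracket :: "hv_basis \<Rightarrow> hv_basis \<Rightarrow> (hv_basis \<Rightarrow>\<^sub>0 complex)" where
  "hv_bracket (LH n) (LH m) =
     Poly_Mapping.single (LH (n + m)) (of_int (n - m)) +
     (if n = - m then Poly_Mapping.single CLH (of_int (n^3 - n) / 12) else 0)"
| "hv_bracket (LH n) (IH m) =
     Poly_Mapping.single (IH (n + m)) (- of_int m) -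
     (if n = - m then Poly_Mapping.single CLIH (of_int (n^2 + n)) else 0)"
| "hv_bracket (IH m) (LH n) =
     - (Poly_Mapping.single (IH (n + m)) (- of_int m) -
        (if n = - m then Poly_Mapping.single CLIH (of_int (n^2 + n)) else 0))"
| "hv_bracket (IH n) (IH m) =
     (if n = - m then Poly_Mapping.single CIH (of_int n) else 0)"
| "hv_bracket _ _ = 0"

definition hv_neg :: "hv_basis set" where
  "hv_neg = {LH (- n) | n. n \<ge> 1} \<union> {IH (- n) | n. n \<ge> 1}"

text \<open>The parameters are ordered \<open>(c\<^sub>L, c\<^sub>I, c\<^sub>L\<^sub>,\<^sub>I, h, h\<^sub>I)\<close>.\<close>

definition hv_verma ::
  "(complex \<Rightarrow> 'v \<Rightarrow> 'v::ab_group_add) \<Rightarrow> (hv_basis \<Rightarrow> 'v \<Rightarrow> 'v) \<Rightarrow> 'v \<Rightarrow>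
   complex \<Rightarrow> complex \<Rightarrow> complex \<Rightarrow> complex \<Rightarrow> complex \<Rightarrow> bool"
where
  "hv_verma scale \<rho> v c\<^sub>L c\<^sub>I c\<^sub>L\<^sub>I h h\<^sub>I \<longleftrightarrow>
     lie_module hv_bracket scale \<rho> \<and>
     (\<forall>u. \<rho> CLH u = scale c\<^sub>L u \<and> \<rho> CIH u = scale c\<^sub>I u \<and> \<rho> CLIH u = scale c\<^sub>L\<^sub>I u) \<and>
     (\<forall>n>0. \<rho> (LH n) v = 0 \<and> \<rho> (IH n) v = 0) \<and>
     \<rho> (LH 0) v = scale h v \<and> \<rho> (IH 0) v = scale h\<^sub>I v \<and>
     free_over_uea hv_bracket scale \<rho> hv_neg v"


section \<open>The algebra W(2,2) and its Verma modules\<close>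

datatype w22_basis = LW int | WW int | CW | CWW

fun w22_bracket :: "w22_basis \<Rightarrow> w22_basis \<Rightarrow> (w22_basis \<Rightarrow>\<^sub>0 complex)" where
  "w22_bracket (LW n) (LW m) =
     Poly_Mapping.single (LW (n + m)) (of_int (n - m)) +
     (if n = - m then Poly_Mapping.single CW (of_int (n^3 - n) / 12) else 0)"
| "w22_bracket (LW n) (WW m) =
     Poly_Mapping.single (WW (n + m)) (of_int (n - m)) +
     (if n = - m then Poly_Mapping.single CWW (of_int (n^3 - n) / 12) else 0)"
| "w22_bracket (WW m) (LW n) =
     - (Poly_Mapping.single (WW (n + m)) (of_int (n - m)) +
        (if n = - m then Poly_Mapping.single CWW (of_int (n^3 - n) / 12) else 0))"
| "w22_bracket _ _ = 0"

definition w22_neg :: "w22_basis set" where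
  "w22_neg = {LW (- n) | n. n \<ge> 1} \<union> {WW (- n) | n. n \<ge> 1}"

definition w22_verma ::
  "(complex \<Rightarrow> 'v \<Rightarrow> 'v::ab_group_add) \<Rightarrow> (w22_basis \<Rightarrow> 'v \<Rightarrow> 'v) \<Rightarrow> 'v \<Rightarrow>
   complex \<Rightarrow> complex \<Rightarrow> complex \<Rightarrow> complex \<Rightarrow> bool"
where
  "w22_verma scale \<rho> v c\<^sub>L c\<^sub>W h h\<^sub>W \<longleftrightarrow>
     lie_module w22_bracket scale \<rho> \<and>
     (\<forall>u. \<rho> CW u = scale c\<^sub>L u \<and> \<rho> CWW u = scale c\<^sub>W u) \<and>
     (\<forall>n>0. \<rho> (LW n) v = 0 \<and> \<rho> (WW n) v = 0) \<and>
     \<rho> (LW 0) v = scale h v \<and> \<rho> (WW 0) v = scale h\<^sub>W v \<and>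
     free_over_uea w22_bracket scale \<rho> w22_neg v"

definition w22_singular_vector ::
  "(complex \<Rightarrow> 'v \<Rightarrow> 'v::ab_group_add) \<Rightarrow> (w22_basis \<Rightarrow> 'v \<Rightarrow> 'v) \<Rightarrow> complex \<Rightarrow> nat \<Rightarrow> 'v \<Rightarrow> bool"
where
  "w22_singular_vector scale \<rho> h p u \<longleftrightarrow>
     u \<noteq> 0 \<and>
     (\<forall>n>0. \<rho> (LW n) u = 0 \<and> \<rho> (WW n) u = 0) \<and>
     \<rho> (LW 0) u = scale (h + of_nat p) u"


section \<open>The W(2,2)-action on Heisenberg-Virasoro modules\<close>

text \<open>
  The normally ordered product \<open>:I(k)I(m):\<close> has the creation operators (negative modes) on the
  left. With \<open>I(z) = \<Sum>\<^sub>n I(n) z\<^sup>-\<^sup>n\<^sup>-\<^sup>1\<close>, the coefficient of \<open>z\<^sup>-\<^sup>n\<^sup>-\<^sup>2\<close> in \<open>:I(z)\<^sup>2:\<close> is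
  \<open>\<Sum>\<^sub>k :I(k)I(n-k):\<close>, and in the derivative of \<open>I(z)\<close> it is \<open>-(n+1) I(n)\<close>. On a given vector of a
  highest weight module only finitely many summands of \<open>\<Sum>\<^sub>k\<close> are nonzero, as \<open>Sum_any\<close> requires.
\<close>

definition normal_ordered_II :: "(hv_basis \<Rightarrow> 'v \<Rightarrow> 'v) \<Rightarrow> int \<Rightarrow> int \<Rightarrow> 'v \<Rightarrow> 'v" where
  "normal_ordered_II \<rho> k m u =
     (if k < 0 then \<rho> (IH k) (\<rho> (IH m) u) else \<rho> (IH m) (\<rho> (IH k) u))"

definition W_mode ::
  "(complex \<Rightarrow> 'v \<Rightarrow> 'v::ab_group_add) \<Rightarrow> (hv_basis \<Rightarrow> 'v \<Rightarrow> 'v) \<Rightarrow> complex \<Rightarrow> int \<Rightarrow> 'v \<Rightarrow> 'v"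
where
  "W_mode scale \<rho> c\<^sub>L\<^sub>I n u =
     Sum_any (\<lambda>k. normal_ordered_II \<rho> k (n - k) u) +
     scale (2 * c\<^sub>L\<^sub>I) (scale (- of_int (n + 1)) (\<rho> (IH n) u))"

fun w22_act_on_hv ::
  "(complex \<Rightarrow> 'v \<Rightarrow> 'v::ab_group_add) \<Rightarrow> (hv_basis \<Rightarrow> 'v \<Rightarrow> 'v) \<Rightarrow> complex \<Rightarrow> complex \<Rightarrow> complex \<Rightarrow>
   w22_basis \<Rightarrow> 'v \<Rightarrow> 'v"
where
  "w22_act_on_hv scale \<rho> c\<^sub>L c\<^sub>W c\<^sub>L\<^sub>I (LW n) = \<rho> (LH n)"
| "w22_act_on_hv scale \<rho> c\<^sub>L c\<^sub>W c\<^sub>L\<^sub>I (WW n) = W_mode scale \<rho> c\<^sub>L\<^sub>I n"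
| "w22_act_on_hv scale \<rho> c\<^sub>L c\<^sub>W c\<^sub>L\<^sub>I CW = scale c\<^sub>L"
| "w22_act_on_hv scale \<rho> c\<^sub>L c\<^sub>W c\<^sub>L\<^sub>I CWW = scale c\<^sub>W"


section \<open>Schur polynomials\<close>

text \<open>
  Multivariate polynomials in \<open>x\<^sub>1, x\<^sub>2, \<dots>\<close> over the complex numbers; a monomial is the finitely
  supported function giving the exponent of each variable.
\<close>

type_synonym cpoly = "(nat \<Rightarrow>\<^sub>0 nat) \<Rightarrow>\<^sub>0 complex"

definition poly_const :: "complex \<Rightarrow> cpoly" where
  "poly_const c = Poly_Mapping.single 0 c"

definition poly_var :: "nat \<Rightarrow> cpoly" where
  "poly_var n = Poly_Mapping.single (Poly_Mapping.single n 1) 1"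

definition schur_exponent :: "cpoly fps" where
  "schur_exponent = Abs_fps (\<lambda>n. if n = 0 then 0 else poly_const (1 / of_nat n) * poly_var n)"

text \<open>
  \<open>fps_exp\<close> is restricted to coefficient fields, hence the exponential series with
  polynomial coefficients is written out.
\<close>

definition poly_exp_series :: "cpoly fps" where
  "poly_exp_series = Abs_fps (\<lambda>k. poly_const (1 / fact k))"

definition schur_poly :: "nat \<Rightarrow> cpoly" where
  "schur_poly r = fps_nth (poly_exp_series oo schur_exponent) r"

text \<open>
  \<open>poly_act scale A P u\<close> is \<open>P(A\<^sub>1, A\<^sub>2, \<dots>) u\<close> for pairwise commuting operators \<open>A\<^sub>n\<close>; the order of
  composition chosen here (increasing index) is then irrelevant.
\<close>

definition monomial_act :: "(nat \<Rightarrow> 'v \<Rightarrow> 'v) \<Rightarrow> (nat \<Rightarrow>\<^sub>0 nat) \<Rightarrow> 'v \<Rightarrow> 'v" where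
  "monomial_act A m u =
     foldr (\<lambda>n. A n ^^ Poly_Mapping.lookup m n) (sorted_list_of_set (Poly_Mapping.keys m)) u"

definition poly_act ::
  "(complex \<Rightarrow> 'v \<Rightarrow> 'v::ab_group_add) \<Rightarrow> (nat \<Rightarrow> 'v \<Rightarrow> 'v) \<Rightarrow> cpoly \<Rightarrow> 'v \<Rightarrow> 'v"
where
  "poly_act scale A P u =
     (\<Sum>m\<in>Poly_Mapping.keys P. scale (Poly_Mapping.lookup P m) (monomial_act A m u))"

end

(* W(z) = :I(z)^2: + 2 c_LI dI/dz makes W(-n) act as 2 c_LI (p + n) I(-n) plus terms which either
   contain more I's or have an I(-m) with m > n on the left. By triangularity the image of \<Psi> is
   everything, degree by degree. The degree-bounded parts of the W(2,2)-Verma module are spanned by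
   words taken up to permutation, and the corresponding words are linearly independent in the
   Heisenberg-Virasoro Verma module, so counting gives injectivity. The independence (the hard half
   of PBW) comes from a concrete representation: the Lie algebra acts by derivations on polynomials in
   a_1, a_2, ..., b_1, b_2, ..., where x + sum a_k x^(k+1) and sum b_k x^k are the generic formal
   diffeomorphism and function.

   The vectors s_r = S_r(-I(-1)/c_LI, ...) v satisfy r s_r = sum_k X_k s_(r-k) with
   X_k = -I(-k)/c_LI, whence L(n) s_r = (r - p) s_(r-n) for n > 0; this vanishes at r = p.
   The I(n) with n > 0 commute with all X_k and kill v, so W(n) s_r = 0. *)

theory Submission
  imports Defs "HOL-Library.Function_Algebras" "HOL-Library.Multiset"
begin

section \<open>Linear extension and words of operators\<close>

text \<open>The equation for h_W has the two roots h_I = (1 + p) c_LI and h_I = (1 - p) c_LI. At the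
  first, the diagonal coefficient 2 h_I + 2 c_LI (n - 1) of W(-n) never vanishes for n \<ge> 1; at
  the second it would be 2 c_LI (n - p), which is zero at n = p, and triangularity would fail there.
  The Verma modules are given only by the kernel of the map from a tensor algebra, so neither comes
  with a basis. The two counts match because the negative halves of the two algebras have equally
  many letters in each degree; their brackets are never compared. Bounding the degree, instead of
  fixing it, gives finite-dimensional pieces without first decomposing the modules.\<close>

locale lin_space = vector_space scale
  for scale :: "'a::field \<Rightarrow> 'b::ab_group_add \<Rightarrow> 'b"
begin

definition lin_ext :: "('g \<Rightarrow> 'b) \<Rightarrow> ('g \<Rightarrow>\<^sub>0 'a) \<Rightarrow> 'b" where
  "lin_ext f a = (\<Sum>z\<in>Poly_Mapping.keys a. scale (Poly_Mapping.lookup a z) (f z))"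

lemma lin_ext_superset:
  fixes a :: "'g \<Rightarrow>\<^sub>0 'a"
  assumes "finite K" "Poly_Mapping.keys a \<subseteq> K"
  shows "lin_ext f a = (\<Sum>z\<in>K. scale (Poly_Mapping.lookup a z) (f z))"
  unfolding lin_ext_def using assms
  by (intro sum.mono_neutral_left) (auto simp: in_keys_iff)

lemma lin_ext_0 [simp]: "lin_ext f 0 = 0"
  by (simp add: lin_ext_def)

lemma lin_ext_single [simp]: "lin_ext f (Poly_Mapping.single z c) = scale c (f z)"
  by (subst lin_ext_superset[of "{z}"]) auto

lemma lin_ext_add: "lin_ext f (a + b) = lin_ext f a + lin_ext f b"
  using Poly_Mapping.keys_add[of a b]
  by (simp add: lin_ext_superset[of "Poly_Mapping.keys a \<union> Poly_Mapping.keys b"]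
      lookup_add scale_left_distrib sum.distrib)

lemma lin_ext_uminus: "lin_ext f (- a) = - lin_ext f a"
  using lin_ext_add[of f a "- a"] by (simp add: eq_neg_iff_add_eq_0 add.commute)

lemma lin_ext_diff: "lin_ext f (a - b) = lin_ext f a - lin_ext f b"
  using lin_ext_add[of f a "- b"] by (simp add: lin_ext_uminus)

lemma lin_ext_sum: "lin_ext f (sum a I) = (\<Sum>i\<in>I. lin_ext f (a i))"
  by (induction I rule: infinite_finite_induct) (auto simp: lin_ext_add)

lemma lin_ext_scale: "lin_ext f (Poly_Mapping.map ((*) c) a) = scale c (lin_ext f a)"
proof -
  have "Poly_Mapping.keys (Poly_Mapping.map ((*) c) a) \<subseteq> Poly_Mapping.keys a"
    by (auto simp: in_keys_iff map.rep_eq when_def)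
  then have "lin_ext f (Poly_Mapping.map ((*) c) a) =
      (\<Sum>z\<in>Poly_Mapping.keys a. scale (c * Poly_Mapping.lookup a z) (f z))"
    by (subst lin_ext_superset[of "Poly_Mapping.keys a"])
      (auto simp: map.rep_eq when_def intro!: sum.cong)
  then show ?thesis
    by (simp add: lin_ext_def scale_sum_right)
qed

text \<open>Steinitz exchange: a nontrivial relation would make one \<open>f a\<close> redundant,
  and fewer than \<open>card A\<close> vectors would span the \<open>card A\<close> independent
  vectors \<open>g a\<close>. Indexed families are used so that a repeated value counts as a
  dependence.\<close>

lemma independent_family_if_spans_independent_family:
  assumes A: "finite A"
    and g: "\<And>c. (\<Sum>a\<in>A. scale (c a) (g a)) = 0 \<Longrightarrow> \<forall>a\<in>A. c a = 0"
    and sp: "\<And>a. a \<in> A \<Longrightarrow> g a \<in> span (f ` A)"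
    and c: "(\<Sum>a\<in>A. scale (c a) (f a)) = 0"
  shows "\<forall>a\<in>A. c a = 0"
proof (rule ccontr)
  assume "\<not> (\<forall>a\<in>A. c a = 0)"
  then obtain a where a: "a \<in> A" "c a \<noteq> 0" by auto
  let ?B = "f ` (A - {a})"
  have "scale (c a) (f a) = - (\<Sum>x\<in>A - {a}. scale (c x) (f x))"
    using c A a by (simp add: sum.remove eq_neg_iff_add_eq_0)
  then have "scale (c a) (f a) \<in> span ?B"
    by (simp only:) (intro span_neg span_sum span_scale span_base imageI)
  then have "scale (1 / c a) (scale (c a) (f a)) \<in> span ?B"
    by (rule span_scale)
  then have fa: "f a \<in> span ?B" using a by simp
  have "f ` A \<subseteq> span ?B"
    using fa by (auto intro: span_base)
  then have "span (f ` A) \<subseteq> span ?B"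
    by (simp add: span_minimal)
  then have sub: "g ` A \<subseteq> span ?B" using sp by auto
  have inj: "inj_on g A"
  proof (rule inj_onI, rule ccontr)
    fix x y assume xy: "x \<in> A" "y \<in> A" "g x = g y" "x \<noteq> y"
    \<comment> \<open>Equal values at two indices would give the relation g x - g y = 0. Injectivity
      ensures that \<open>g\<close> takes as many values as \<open>A\<close> has elements.\<close>
    define e where "e = (\<lambda>z. if z = x then 1 else if z = y then - 1 else 0 :: 'a)"
    have "(\<Sum>z\<in>A. scale (e z) (g z)) = (\<Sum>z\<in>{x, y}. scale (e z) (g z))"
      using xy A by (intro sum.mono_neutral_right) (auto simp: e_def)
    also have "\<dots> = 0" using xy by (simp add: e_def)
    finally have "e x = 0" using g[of e] xy by blast
    then show False by (simp add: e_def)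
  qed
  have "independent (g ` A)"
    unfolding dependent_finite[OF finite_imageI[OF A]]
  proof (safe)
    fix u x assume *: "(\<Sum>v\<in>g ` A. scale (u v) v) = 0" "x \<in> A" "u (g x) \<noteq> 0"
    have "(\<Sum>z\<in>A. scale (u (g z)) (g z)) = 0"
      using *(1) by (simp add: sum.reindex[OF inj])
    then show False using g[of "\<lambda>z. u (g z)"] * by auto
  qed
  then have "card (g ` A) \<le> card ?B"
    using independent_span_bound[of ?B "g ` A"] sub A by auto
  also have "\<dots> \<le> card (A - {a})" using A by (intro card_image_le) auto
  also have "\<dots> < card A" using A a by (intro psubset_card_mono) auto
  finally show False using inj by (simp add: card_image)
qed

end

locale linear_operators = lin_space scale
  for scale :: "'a::field \<Rightarrow> 'v::ab_group_add \<Rightarrow> 'v" +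
  fixes \<rho> :: "'g \<Rightarrow> 'v \<Rightarrow> 'v"
  assumes linear_op: "Vector_Spaces.linear scale scale (\<rho> x)"
begin

lemma op_add: "\<rho> x (u + w) = \<rho> x u + \<rho> x w"
  and op_scale: "\<rho> x (scale c u) = scale c (\<rho> x u)"
  and op_zero [simp]: "\<rho> x 0 = 0"
  and op_diff: "\<rho> x (u - w) = \<rho> x u - \<rho> x w"
  and op_neg: "\<rho> x (- u) = - \<rho> x u"
  and op_sum: "\<rho> x (sum f I) = (\<Sum>i\<in>I. \<rho> x (f i))"
proof -
  interpret l: Vector_Spaces.linear scale scale "\<rho> x" by (rule linear_op)
  show "\<rho> x (u + w) = \<rho> x u + \<rho> x w" "\<rho> x (scale c u) = scale c (\<rho> x u)" "\<rho> x 0 = 0"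
    "\<rho> x (u - w) = \<rho> x u - \<rho> x w" "\<rho> x (- u) = - \<rho> x u"
    "\<rho> x (sum f I) = (\<Sum>i\<in>I. \<rho> x (f i))"
    by (simp_all add: l.add l.scale l.zero l.diff l.neg l.sum)
qed

lemma word_add: "foldr \<rho> w (u + u') = foldr \<rho> w u + foldr \<rho> w u'"
  by (induction w) (auto simp: op_add)

lemma word_diff: "foldr \<rho> w (u - u') = foldr \<rho> w u - foldr \<rho> w u'"
  by (induction w) (auto simp: op_diff)

lemma word_scale: "foldr \<rho> w (scale c u) = scale c (foldr \<rho> w u)"
  by (induction w) (auto simp: op_scale)

lemma word_zero [simp]: "foldr \<rho> w 0 = 0"
  by (induction w) auto

lemma word_sum: "foldr \<rho> w (sum f I) = (\<Sum>i\<in>I. foldr \<rho> w (f i))"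
  by (induction I rule: infinite_finite_induct) (auto simp: word_add)

lemma op_lin_ext: "\<rho> x (lin_ext f a) = lin_ext (\<lambda>z. \<rho> x (f z)) a"
  by (simp add: lin_ext_def op_sum op_scale)

lemma op_span:
  assumes "\<And>b. b \<in> B \<Longrightarrow> \<rho> x b \<in> span C" "u \<in> span B"
  shows "\<rho> x u \<in> span C"
  using assms(2)
proof (induction rule: span_induct_alt)
  case (step c y z)
  then show ?case using assms(1) by (simp add: op_add op_scale span_add span_scale)
qed (simp add: span_zero)

end

lemma tensor_act_eq:
  "vector_space scale \<Longrightarrow>
   tensor_act scale \<rho> a u = lin_space.lin_ext scale (\<lambda>w. foldr \<rho> w u) a"
  by (simp add: tensor_act_def lin_space.lin_ext_def lin_space_def)

lemma poly_act_eq: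
  "vector_space scale \<Longrightarrow>
   poly_act scale A P u = lin_space.lin_ext scale (\<lambda>m. monomial_act A m u) P"
  by (simp add: poly_act_def lin_space.lin_ext_def lin_space_def)

lemma lie_module_linear_operators: "lie_module br scale \<rho> \<Longrightarrow> linear_operators scale \<rho>"
  by (simp add: lie_module_def linear_operators_def linear_operators_axioms_def lin_space_def)

lemma lie_module_bracket:
  assumes "lie_module br scale \<rho>"
  shows "\<rho> x (\<rho> y u) - \<rho> y (\<rho> x u) = lin_space.lin_ext scale (\<lambda>z. \<rho> z u) (br x y)"
  using assms by (simp add: lie_module_def lin_space.lin_ext_def lin_space_def)

lemma vector_space_tensor_scale: "vector_space tensor_scale"
proof
  show "tensor_scale a (x + y) = tensor_scale a x + tensor_scale a y" for a x y
    by (rule poly_mapping_eqI) (simp add: tensor_scale_def map.rep_eq when_def lookup_add flip: distrib_left)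
  show "tensor_scale (a + b) x = tensor_scale a x + tensor_scale b x" for a b x
    by (rule poly_mapping_eqI) (simp add: tensor_scale_def map.rep_eq when_def lookup_add distrib_right)
  show "tensor_scale a (tensor_scale b x) = tensor_scale (a * b) x" for a b x
    by (rule poly_mapping_eqI) (simp add: tensor_scale_def map.rep_eq when_def)
  show "tensor_scale 1 x = x" for x
    by (rule poly_mapping_eqI) (simp add: tensor_scale_def map.rep_eq when_def)
qed

section \<open>Modules free of rank one over an enveloping algebra\<close>

lemma free_over_uea_span:
  assumes "vector_space scale" "free_over_uea br scale \<rho> S v"
  shows "u \<in> module.span scale {foldr \<rho> w v | w. w \<in> lists S}"
proof -
  interpret vector_space scale by fact
  obtain a where a: "a \<in> tensor_algebra S" "u = tensor_act scale \<rho> a v"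
    using assms(2) unfolding free_over_uea_def by blast
  have "scale (Poly_Mapping.lookup a w) (foldr \<rho> w v) \<in> span {foldr \<rho> w v | w. w \<in> lists S}"
    if "w \<in> Poly_Mapping.keys a" for w
    using that a(1) by (intro span_scale span_base) (auto simp: tensor_algebra_def)
  then show ?thesis
    unfolding a(2) tensor_act_def by (intro span_sum)
qed

text \<open>Universal property of T(S)/J(S): evaluating words at \<open>x0\<close> kills all
  relators, and by freeness these span the kernel of T(S) -> V, so the evaluation factors through V.
  Any representation of the relations among letters of \<open>S\<close> thus yields a linear map out
  of the Verma module.\<close>

lemma free_over_uea_lift:
  assumes free: "free_over_uea br scale \<rho> S v"
    and V: "linear_operators scale \<rho>" and X: "linear_operators scale' \<rho>'"
    and rel: "\<And>x y u. x \<in> S \<Longrightarrow> y \<in> S \<Longrightarrow>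
      \<rho>' x (\<rho>' y u) - \<rho>' y (\<rho>' x u) = lin_space.lin_ext scale' (\<lambda>z. \<rho>' z u) (br x y)"
  obtains \<Theta> where "Vector_Spaces.linear scale scale' \<Theta>" "\<Theta> v = x0"
    "\<And>x u. x \<in> S \<Longrightarrow> \<Theta> (\<rho> x u) = \<rho>' x (\<Theta> u)"
proof -
  interpret V: linear_operators scale \<rho> by fact
  interpret X: linear_operators scale' \<rho>' by fact
  interpret T: vector_space "tensor_scale :: complex \<Rightarrow> ('a list \<Rightarrow>\<^sub>0 complex) \<Rightarrow> _"
    by (rule vector_space_tensor_scale)
  define act where "act = V.lin_ext (\<lambda>w. foldr \<rho> w v)"
  define act' where "act' = X.lin_ext (\<lambda>w. foldr \<rho>' w x0)"
  have surj: "\<exists>a\<in>tensor_algebra S. act a = u" for u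
  proof -
    have "u \<in> (\<lambda>a. tensor_act scale \<rho> a v) ` tensor_algebra S"
      using free by (simp add: free_over_uea_def)
    then show ?thesis
      by (auto simp: act_def tensor_act_eq[OF V.vector_space_axioms])
  qed
  have T_add: "a + b \<in> tensor_algebra S" if "a \<in> tensor_algebra S" "b \<in> tensor_algebra S" for a b
    using that Poly_Mapping.keys_add[of a b] by (auto simp: tensor_algebra_def)
  have T_diff: "a - b \<in> tensor_algebra S" if "a \<in> tensor_algebra S" "b \<in> tensor_algebra S" for a b
    using that keys_diff[of a b] by (auto simp: tensor_algebra_def)
  have T_scale: "tensor_scale c a \<in> tensor_algebra S" if "a \<in> tensor_algebra S" for a c
    using that by (auto simp: tensor_algebra_def tensor_scale_def in_keys_iff map.rep_eq when_def subset_eq)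
  have rel0: "act' (uea_relator br s x y t) = 0" if "x \<in> S" "y \<in> S" for s x y t
  proof -
    have "act' (uea_relator br s x y t) =
       foldr \<rho>' s (\<rho>' x (\<rho>' y (foldr \<rho>' t x0)) - \<rho>' y (\<rho>' x (foldr \<rho>' t x0))
         - X.lin_ext (\<lambda>z. \<rho>' z (foldr \<rho>' t x0)) (br x y))"
      by (simp add: act'_def uea_relator_def X.lin_ext_diff X.lin_ext_sum X.word_diff X.word_sum
          X.word_scale X.lin_ext_def[of "\<lambda>z. \<rho>' z (foldr \<rho>' t x0)"])
    then show ?thesis using rel[OF that] by simp
  qed
  have sub: "T.subspace {a. act' a = 0}"
    by (rule T.subspaceI) (auto simp: act'_def X.lin_ext_add tensor_scale_def X.lin_ext_scale)
  have ideal: "act' a = 0" if "a \<in> uea_ideal br S" for a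
    using T.span_minimal[OF _ sub, of "{uea_relator br s x y t | s x y t. s \<in> lists S \<and> x \<in> S \<and> y \<in> S \<and> t \<in> lists S}"]
      rel0 that unfolding uea_ideal_def by blast
  have wd: "act' a = act' b" if "a \<in> tensor_algebra S" "b \<in> tensor_algebra S" "act a = act b" for a b
  proof -
    have "a - b \<in> {a \<in> tensor_algebra S. tensor_act scale \<rho> a v = 0}"
      using that T_diff by (simp add: tensor_act_eq[OF V.vector_space_axioms] act_def V.lin_ext_diff)
    then have "act' (a - b) = 0"
      using free ideal unfolding free_over_uea_def by blast
    then show ?thesis by (simp add: act'_def X.lin_ext_diff)
  qed
  define \<Theta> where "\<Theta> u = act' (SOME a. a \<in> tensor_algebra S \<and> act a = u)" for u
  have \<Theta>: "\<Theta> (act a) = act' a" if "a \<in> tensor_algebra S" for a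
    unfolding \<Theta>_def using someI[of "\<lambda>b. b \<in> tensor_algebra S \<and> act b = act a" a] that wd by blast
  show ?thesis
  proof (rule that[of \<Theta>])
    show "Vector_Spaces.linear scale scale' \<Theta>"
      unfolding Vector_Spaces.linear_iff
    proof (intro conjI allI)
      show "\<Theta> (u + w) = \<Theta> u + \<Theta> w" for u w
      proof -
        obtain a b where *: "a \<in> tensor_algebra S" "act a = u" "b \<in> tensor_algebra S" "act b = w"
          using surj by meson
        have "\<Theta> (u + w) = \<Theta> (act (a + b))" using * by (simp add: act_def V.lin_ext_add)
        also have "\<dots> = act' a + act' b"
          using * T_add by (subst \<Theta>) (auto simp: act'_def X.lin_ext_add)
        finally show ?thesis using * \<Theta> by auto
      qed
      show "\<Theta> (scale c u) = scale' c (\<Theta> u)" for c u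
      proof -
        obtain a where *: "a \<in> tensor_algebra S" "act a = u"
          using surj by meson
        have "\<Theta> (scale c u) = \<Theta> (act (tensor_scale c a))"
          using * by (simp add: act_def tensor_scale_def V.lin_ext_scale)
        also have "\<dots> = scale' c (act' a)"
          using * T_scale by (subst \<Theta>) (auto simp: act'_def tensor_scale_def X.lin_ext_scale)
        finally show ?thesis using * \<Theta> by auto
      qed
    qed (rule V.vector_space_axioms X.vector_space_axioms)+
    have "Poly_Mapping.single [] 1 \<in> tensor_algebra S" by (simp add: tensor_algebra_def)
    from \<Theta>[OF this] show "\<Theta> v = x0" by (simp add: act_def act'_def)
    show "\<Theta> (\<rho> x u) = \<rho>' x (\<Theta> u)" if x: "x \<in> S" for x u
    proof -
      obtain a where *: "a \<in> tensor_algebra S" "act a = u"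
        using surj by meson
      \<comment> \<open>\<open>b\<close> is the product of the letter \<open>x\<close> with
        \<open>a\<close> in the tensor algebra, a preimage of \<open>\<rho> x u\<close>.\<close>
      define b where "b = (\<Sum>w\<in>Poly_Mapping.keys a. Poly_Mapping.single (x # w) (Poly_Mapping.lookup a w))"
      have "Poly_Mapping.keys b \<subseteq> (\<Union>w\<in>Poly_Mapping.keys a. {x # w})"
        unfolding b_def by (rule order_trans[OF keys_sum]) auto
      then have b: "b \<in> tensor_algebra S"
        using * x unfolding tensor_algebra_def by fastforce
      have "\<rho> x u = act b"
        unfolding *(2)[symmetric] act_def b_def
        by (simp add: V.op_lin_ext V.lin_ext_sum) (simp add: V.lin_ext_def)
      then have "\<Theta> (\<rho> x u) = act' b" using \<Theta>[OF b] by simp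
      also have "\<dots> = \<rho>' x (act' a)"
        unfolding act'_def b_def
        by (simp add: X.op_lin_ext X.lin_ext_sum) (simp add: X.lin_ext_def)
      finally show ?thesis using * \<Theta> by auto
    qed
  qed
qed

section \<open>Linear independence of words in the Heisenberg-Virasoro Verma module\<close>

text \<open>
  The letters \<open>LH (- k)\<close> and \<open>IH (- k)\<close> stand for \<open>a\<^sub>k\<close> and \<open>b\<^sub>k\<close>. Up to signs, \<open>LH (- n)\<close> is the
  derivation induced by \<open>x\<^sup>n\<^sup>+\<^sup>1 d/dx\<close>, sending \<open>a\<^sub>m\<close> to \<open>(m - n + 1) a\<^sub>m\<^sub>-\<^sub>n\<close> (with \<open>a\<^sub>0 = 1\<close>) and \<open>b\<^sub>m\<close> to
  \<open>(m - n) b\<^sub>m\<^sub>-\<^sub>n\<close>, and \<open>IH (- n)\<close> is \<open>\<partial>/\<partial>b\<^sub>n\<close>. \<open>coder\<close> is the transpose of such a derivation: it acts on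
  functionals, given by their values on words. Commutativity of the variables is not needed.
\<close>

fun coder_gen :: "hv_basis \<Rightarrow> hv_basis \<Rightarrow> (hv_basis list \<Rightarrow> complex) \<Rightarrow> hv_basis list \<Rightarrow> complex" where
  "coder_gen (LH n) (LH m) \<phi> ys =
     (if m < n then of_int (n - m + 1) * \<phi> (LH (m - n) # ys) else if m = n then \<phi> ys else 0)"
| "coder_gen (LH n) (IH m) \<phi> ys = (if m < n then of_int (n - m) * \<phi> (IH (m - n) # ys) else 0)"
| "coder_gen (IH n) (IH m) \<phi> ys = (if m = n then \<phi> ys else 0)"
| "coder_gen _ _ _ _ = 0"

fun coder :: "hv_basis \<Rightarrow> (hv_basis list \<Rightarrow> complex) \<Rightarrow> hv_basis list \<Rightarrow> complex" where
  "coder x \<phi> [] = 0"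
| "coder x \<phi> (y # ys) = coder_gen x y \<phi> ys + coder x (\<lambda>zs. \<phi> (y # zs)) ys"

definition fun_scale :: "complex \<Rightarrow> ('m \<Rightarrow> complex) \<Rightarrow> 'm \<Rightarrow> complex" where
  "fun_scale c \<phi> = (\<lambda>M. c * \<phi> M)"

lemma vector_space_fun_scale: "vector_space fun_scale"
  by standard (auto simp: fun_scale_def fun_eq_iff algebra_simps)

lemma coder_gen_add:
  "coder_gen x y (\<lambda>M. \<phi> M + \<psi> M) ys = coder_gen x y \<phi> ys + coder_gen x y \<psi> ys"
  by (cases "(x, y, \<phi>, ys)" rule: coder_gen.cases) (auto simp: distrib_left)

lemma coder_gen_scale: "coder_gen x y (\<lambda>M. c * \<phi> M) ys = c * coder_gen x y \<phi> ys"
  by (cases "(x, y, \<phi>, ys)" rule: coder_gen.cases) auto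

lemma coder_add: "coder x (\<lambda>M. \<phi> M + \<psi> M) ys = coder x \<phi> ys + coder x \<psi> ys"
  by (induction ys arbitrary: \<phi> \<psi>) (simp_all add: coder_gen_add)

lemma coder_scale: "coder x (\<lambda>M. c * \<phi> M) ys = c * coder x \<phi> ys"
  by (induction ys arbitrary: \<phi>) (simp_all add: coder_gen_scale distrib_left)

lemma coder_zero: "coder x (\<lambda>M. 0) ys = 0"
  using coder_scale[of x 0 "\<lambda>M. 0" ys] by simp

text \<open>A commutator of derivations is a derivation: the mixed terms, where one operator hits
  the head and the other the tail, cancel. What remains is the tail, known by induction, and a check
  on one letter, split according to which of the two operators shifts it.\<close>

lemma coder_L_L:
  assumes "n < 0" "m < 0"
  shows "coder (LH n) (coder (LH m) \<phi>) ys - coder (LH m) (coder (LH n) \<phi>) ys =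
    of_int (n - m) * coder (LH (n + m)) \<phi> ys"
proof (induction ys arbitrary: \<phi>)
  case (Cons y ys)
  have hyp: "coder (LH n) (coder (LH m) (\<lambda>zs. \<phi> (y # zs))) ys =
     coder (LH m) (coder (LH n) (\<lambda>zs. \<phi> (y # zs))) ys +
      of_int (n - m) * coder (LH (n + m)) (\<lambda>zs. \<phi> (y # zs)) ys"
    using Cons[of "\<lambda>zs. \<phi> (y # zs)"] by (simp add: algebra_simps)
  show ?case
  proof (cases y)
    case (LH k)
    consider "n \<le> k" "m \<le> k" | "n \<le> k" "k < m" | "m \<le> k" "k < n" | "k < n" "k < m"
      by linarith
    then show ?thesis
      using assms hyp unfolding LH
      by cases ((simp add: coder_add coder_scale coder_zero; simp add: algebra_simps)+)
  next
    case (IH k)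
    consider "n \<le> k" "m \<le> k" | "n \<le> k" "k < m" | "m \<le> k" "k < n" | "k < n" "k < m"
      by linarith
    then show ?thesis
      using assms hyp unfolding IH
      by cases ((simp add: coder_add coder_scale coder_zero; simp add: algebra_simps)+)
  qed (use hyp in \<open>auto simp: coder_zero algebra_simps\<close>)
qed auto

lemma coder_L_I:
  assumes "n < 0" "m < 0"
  shows "coder (LH n) (coder (IH m) \<phi>) ys - coder (IH m) (coder (LH n) \<phi>) ys =
    - of_int m * coder (IH (n + m)) \<phi> ys"
proof (induction ys arbitrary: \<phi>)
  case (Cons y ys)
  have hyp: "coder (LH n) (coder (IH m) (\<lambda>zs. \<phi> (y # zs))) ys =
     coder (IH m) (coder (LH n) (\<lambda>zs. \<phi> (y # zs))) ys
      - of_int m * coder (IH (n + m)) (\<lambda>zs. \<phi> (y # zs)) ys"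
    using Cons[of "\<lambda>zs. \<phi> (y # zs)"] by (simp add: algebra_simps)
  show ?case
  proof (cases y)
    case (LH k)
    consider "n < k" | "n = k" | "k < n"
      by linarith
    then show ?thesis
      using assms hyp unfolding LH
      by cases ((simp add: coder_add coder_scale coder_zero; simp add: algebra_simps)+)
  next
    case (IH k)
    consider "n \<le> k" "m \<noteq> k" | "n \<le> k" "k = m" | "k < n" "m \<noteq> k" | "k < n" "k = m"
      by linarith
    then show ?thesis
      using assms hyp unfolding IH
      by cases ((simp add: coder_add coder_scale coder_zero; simp add: algebra_simps)+)
  qed (use hyp in \<open>auto simp: coder_zero algebra_simps\<close>)
qed auto

lemma coder_I_I:
  "coder (IH n) (coder (IH m) \<phi>) ys = coder (IH m) (coder (IH n) \<phi>) ys"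
proof (induction ys arbitrary: \<phi>)
  case (Cons y ys)
  have hyp: "coder (IH n) (coder (IH m) (\<lambda>zs. \<phi> (y # zs))) ys =
     coder (IH m) (coder (IH n) (\<lambda>zs. \<phi> (y # zs))) ys"
    using Cons[of "\<lambda>zs. \<phi> (y # zs)"] by simp
  show ?case
  proof (cases y)
    case (IH k)
    then show ?thesis
      using hyp unfolding IH
      by (cases "n = k"; cases "m = k") (auto simp: coder_add coder_scale coder_zero)
  qed (use hyp in \<open>auto simp: coder_zero algebra_simps\<close>)
qed auto

lemma linear_operators_coder: "linear_operators fun_scale coder"
proof -
  interpret vector_space "fun_scale :: complex \<Rightarrow> (hv_basis list \<Rightarrow> complex) \<Rightarrow> _" by (rule vector_space_fun_scale)
  show ?thesis
    by standard (auto simp: fun_scale_def fun_eq_iff coder_add coder_scale plus_fun_def)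
qed

lemma mem_hv_neg_iff: "x \<in> hv_neg \<longleftrightarrow> (\<exists>n<0. x = LH n \<or> x = IH n)"
proof
  assume "\<exists>n<0. x = LH n \<or> x = IH n"
  then obtain n where "n < 0" "x = LH n \<or> x = IH n" by blast
  then show "x \<in> hv_neg" by (auto simp: hv_neg_def intro!: exI[of _ "- n"])
next
  assume "x \<in> hv_neg"
  then obtain n where "n \<ge> 1" "x = LH (- n) \<or> x = IH (- n)" by (auto simp: hv_neg_def)
  then show "\<exists>n<0. x = LH n \<or> x = IH n" by (intro exI[of _ "- n"]) auto
qed

lemma coder_bracket:
  assumes "x \<in> hv_neg" "y \<in> hv_neg"
  shows "coder x (coder y \<phi>) - coder y (coder x \<phi>) = lin_space.lin_ext fun_scale (\<lambda>z. coder z \<phi>) (hv_bracket x y)"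
proof -
  interpret linear_operators fun_scale coder by (rule linear_operators_coder)
  from assms obtain n m where nm: "n < 0" "m < 0" "x = LH n \<or> x = IH n" "y = LH m \<or> y = IH m"
    unfolding mem_hv_neg_iff by blast
  then show ?thesis
    using coder_L_L[of n m \<phi>] coder_L_I[of n m \<phi>] coder_L_I[of m n \<phi>] coder_I_I[of n m \<phi>]
    by (auto simp: fun_eq_iff fun_scale_def lin_ext_diff lin_ext_uminus lin_ext_add algebra_simps)
qed

text \<open>The constant term of a polynomial, that is, evaluation at a = b = 0. It is the image of
  the highest weight vector.\<close>

definition counit :: "hv_basis list \<Rightarrow> complex" where
  "counit M = (if M = [] then 1 else 0)"

text \<open>The derivation shortens a word by at most one letter, so its transpose raises a length
  bound by at most one.\<close>

lemma coder_vanish: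
  assumes "\<And>M. length M > l \<Longrightarrow> \<phi> M = 0" "length M > Suc l"
  shows "coder x \<phi> M = 0"
  using assms
proof (induction M arbitrary: \<phi> l)
  case (Cons y ys)
  have "coder x (\<lambda>zs. \<phi> (y # zs)) ys = 0"
  proof (cases l)
    case 0
    then have "\<phi> (y # zs) = 0" for zs using Cons.prems(1) by auto
    then show ?thesis by (simp add: coder_zero)
  next
    case (Suc k)
    then show ?thesis using Cons.prems by (intro Cons.IH[of k]) auto
  qed
  moreover have "coder_gen x y \<phi> ys = 0"
    using Cons.prems by (cases "(x, y, \<phi>, ys)" rule: coder_gen.cases) auto
  ultimately show ?case by simp
qed simp

text \<open>A letter disappears only when it equals \<open>x\<close>; all other replacements keep
  the length and are killed by \<open>\<phi>\<close>. At top length the operator is therefore the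
  partial derivative with respect to \<open>x\<close>, and each occurrence of \<open>x\<close>
  contributes equally because \<open>\<phi>\<close> sees only the multiset.\<close>

lemma coder_top:
  assumes "x \<in> hv_neg" "\<And>M. length M > l \<Longrightarrow> \<phi> M = 0"
    "\<And>M. length M = l \<Longrightarrow> \<phi> M = F (mset M)" "length M = Suc l"
  shows "coder x \<phi> M = of_nat (count (mset M) x) * F (mset M - {#x#})"
  using assms
proof (induction M arbitrary: \<phi> l F)
  case (Cons y ys)
  have gen: "coder_gen x y \<phi> ys = (if x = y then F (mset ys) else 0)"
    using Cons.prems by (cases "(x, y, \<phi>, ys)" rule: coder_gen.cases) (auto simp: mem_hv_neg_iff)
  show ?case
  proof (cases l)
    case 0
    then show ?thesis using gen Cons.prems by auto
  next
    case (Suc k)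
    have "coder x (\<lambda>zs. \<phi> (y # zs)) ys =
        of_nat (count (mset ys) x) * F (add_mset y (mset ys - {#x#}))"
      using Cons.prems Suc
      by (intro Cons.IH[of k _ "\<lambda>N. F (add_mset y N)"]) auto
    moreover have "add_mset y (mset ys - {#x#}) = mset (y # ys) - {#x#}" if "x \<in># mset ys"
      using that by (auto simp: multiset_eq_iff)
    ultimately show ?thesis using gen
      by (cases "x \<in># mset ys") (auto simp: algebra_simps not_in_iff)
  qed
qed simp

lemma coder_word_vanish:
  "length M > length w \<Longrightarrow> foldr coder w counit M = 0"
  by (induction w arbitrary: M) (auto simp: counit_def intro!: coder_vanish)

text \<open>Iterated partial derivatives pair words of equal length diagonally up to permutation;
  \<open>K\<close> is the product of the factorials of the multiplicities.\<close>

lemma coder_word_top: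
  assumes "w \<in> lists hv_neg"
  shows "\<exists>K::nat. K > 0 \<and> (\<forall>M. length M = length w \<longrightarrow>
     foldr coder w counit M = (if mset M = mset w then of_nat K else 0))"
  using assms
proof (induction w rule: list.induct)
  case (Cons x w)
  then have x: "x \<in> hv_neg" by simp
  from Cons obtain K :: nat where K: "K > 0" and top: "\<And>M. length M = length w \<Longrightarrow>
     foldr coder w counit M = (if mset M = mset w then of_nat K else 0)"
    by (simp only: lists.simps[of "x # w"]) blast
  show ?case
  proof (intro exI[of _ "Suc (count (mset w) x) * K"] conjI allI impI)
    fix M :: "hv_basis list" assume M: "length M = length (x # w)"
    have "foldr coder (x # w) counit M = of_nat (count (mset M) x) *
        (if mset M - {#x#} = mset w then of_nat K else 0)"
      unfolding foldr_Cons comp_def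
      by (rule coder_top[where F = "\<lambda>N. if N = mset w then of_nat K else 0",
            OF x coder_word_vanish top]) (use M in simp_all)
    moreover have "mset M = mset (x # w) \<longleftrightarrow> x \<in># mset M \<and> mset M - {#x#} = mset w"
      unfolding mset.simps by (metis add_mset_remove_trivial insert_DiffM union_single_eq_member)
    moreover have "count (mset M) x = Suc (count (mset w) x)" if "mset M = mset (x # w)"
      unfolding that by simp
    ultimately show "foldr coder (x # w) counit M =
        (if mset M = mset (x # w) then of_nat (Suc (count (mset w) x) * K) else 0)"
      by (cases "x \<in># mset M") (simp_all add: not_in_iff algebra_simps)
  qed (use K in simp)
qed (simp add: counit_def exI[of _ "1::nat"])

text \<open>Among the multisets with nonzero coefficient take one of maximal size, \<open>N\<close>,
  and evaluate at \<open>rep N\<close>. Shorter words vanish there by length, words of the same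
  length by having another multiset. The ordering chosen by \<open>rep\<close> does not affect these
  leading terms.\<close>

lemma coder_words_independent:
  assumes A: "finite A" "\<And>N. N \<in> A \<Longrightarrow> set_mset N \<subseteq> hv_neg"
    and rep: "\<And>N. N \<in> A \<Longrightarrow> mset (rep N) = N"
    and zero: "\<And>M. (\<Sum>N\<in>A. c N * foldr coder (rep N) counit M) = 0"
  shows "\<forall>N\<in>A. c N = 0"
proof (rule ccontr)
  assume nz: "\<not> (\<forall>N\<in>A. c N = 0)"
  define B where "B = {N\<in>A. c N \<noteq> 0}"
  have B: "finite B" "B \<noteq> {}" using A(1) nz by (auto simp: B_def)
  have "Max (size ` B) \<in> size ` B"
    using B by (intro Max_in) auto
  then obtain N where NB: "Max (size ` B) = size N" "N \<in> B" by (rule imageE)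
  have N: "N \<in> B" "size N' \<le> size N" if "N' \<in> B" for N'
    unfolding NB(1)[symmetric] using that B NB(2) by auto
  have NA: "N \<in> A" "c N \<noteq> 0" using NB(2) by (auto simp: B_def)
  define P where "P N' k \<longleftrightarrow> k > 0 \<and> (\<forall>M. length M = length (rep N') \<longrightarrow>
     foldr coder (rep N') counit M = (if mset M = mset (rep N') then of_nat k else 0))" for N' and k :: nat
  have "\<exists>k. P N' k" if "N' \<in> A" for N'
  proof -
    have "set (rep N') \<subseteq> hv_neg" using A(2)[OF that] rep[OF that] by (metis set_mset_mset)
    then have "rep N' \<in> lists hv_neg" by auto
    from coder_word_top[OF this] show ?thesis by (simp only: P_def)
  qed
  then obtain k where "P N' (k N')" if "N' \<in> A" for N' by metis
  then have top: "k N' > 0" "length M = length (rep N') \<Longrightarrow>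
     foldr coder (rep N') counit M = (if mset M = N' then of_nat (k N') else 0)" if "N' \<in> A" for N' M
    using that rep[OF that] by (simp_all add: P_def)
  have len: "length (rep N') = size N'" if "N' \<in> A" for N'
    using rep[OF that] by (metis size_mset)
  have other: "c N' * foldr coder (rep N') counit (rep N) = 0" if N': "N' \<in> A" "N' \<noteq> N" for N'
  proof (cases "c N' = 0")
    case False
    then have le: "size N' \<le> size N" using N(2)[of N'] N' by (simp add: B_def)
    show ?thesis
    proof (cases "size N' = size N")
      case True
      have "foldr coder (rep N') counit (rep N) = 0"
        using top(2)[OF N'(1), of "rep N"] len[OF N'(1)] len[OF NA(1)] rep[OF NA(1)] N'(2) True
        by simp
      then show ?thesis by simp
    next
      case False
      then show ?thesis using le len[OF N'(1)] len[OF NA(1)] by (simp add: coder_word_vanish)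
    qed
  qed simp
  have "foldr coder (rep N) counit (rep N) \<noteq> 0"
    using top(1)[OF NA(1)] top(2)[OF NA(1), of "rep N"] rep[OF NA(1)] by simp
  moreover have "(\<Sum>N'\<in>A. c N' * foldr coder (rep N') counit (rep N)) = c N * foldr coder (rep N) counit (rep N)"
  proof -
    have "(\<Sum>N'\<in>A - {N}. c N' * foldr coder (rep N') counit (rep N)) = 0"
      by (rule sum.neutral) (use other in blast)
    then show ?thesis by (simp only: sum.remove[OF A(1) NA(1)]) simp
  qed
  ultimately show False using zero[of "rep N"] NA(2) by simp
qed

lemma hv_free_lift:
  assumes "lie_module hv_bracket scale \<rho>" "free_over_uea hv_bracket scale \<rho> hv_neg v"
  obtains \<Theta> where "Vector_Spaces.linear scale fun_scale \<Theta>" "\<Theta> v = counit"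
    "\<And>x u. x \<in> hv_neg \<Longrightarrow> \<Theta> (\<rho> x u) = coder x (\<Theta> u)"
  using free_over_uea_lift[OF assms(2) lie_module_linear_operators[OF assms(1)]
      linear_operators_coder coder_bracket] by blast

lemma hv_words_independent:
  assumes "lie_module hv_bracket scale \<rho>" "free_over_uea hv_bracket scale \<rho> hv_neg v"
    and A: "finite A" "\<And>N. N \<in> A \<Longrightarrow> set_mset N \<subseteq> hv_neg"
    and rep: "\<And>N. N \<in> A \<Longrightarrow> mset (rep N) = N"
    and zero: "(\<Sum>N\<in>A. scale (c N) (foldr \<rho> (rep N) v)) = 0"
  shows "\<forall>N\<in>A. c N = 0"
proof -
  obtain \<Theta> where \<Theta>: "Vector_Spaces.linear scale fun_scale \<Theta>" "\<Theta> v = counit"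
    "\<And>x u. x \<in> hv_neg \<Longrightarrow> \<Theta> (\<rho> x u) = coder x (\<Theta> u)"
    using hv_free_lift[OF assms(1,2)] by blast
  interpret \<Theta>: Vector_Spaces.linear scale fun_scale \<Theta> by fact
  have words: "\<Theta> (foldr \<rho> w v) = foldr coder w counit" if "w \<in> lists hv_neg" for w
    using that by (induction w) (auto simp: \<Theta>)
  have "0 = \<Theta> (\<Sum>N\<in>A. scale (c N) (foldr \<rho> (rep N) v))" using zero by (simp add: \<Theta>.zero)
  also have "\<dots> = (\<Sum>N\<in>A. fun_scale (c N) (foldr coder (rep N) counit))"
    unfolding \<Theta>.sum \<Theta>.scale
  proof (intro sum.cong refl arg_cong2[where f = fun_scale])
    fix N assume N: "N \<in> A"
    have "rep N \<in> lists hv_neg" using A(2)[OF N] rep[OF N] by (metis in_listsI set_mset_mset subset_iff)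
    then show "\<Theta> (foldr \<rho> (rep N) v) = foldr coder (rep N) counit" by (rule words)
  qed
  finally have sum0: "(\<Sum>N\<in>A. fun_scale (c N) (foldr coder (rep N) counit)) = 0" by simp
  have eval: "(\<Sum>N\<in>A. fun_scale (c N) (foldr coder (rep N) counit)) M =
      (\<Sum>N\<in>A. c N * foldr coder (rep N) counit M)" for M
    using A(1) by (induction A rule: finite_induct) (auto simp: fun_scale_def)
  have "(\<Sum>N\<in>A. c N * foldr coder (rep N) counit M) = 0" for M
    using eval[of M] fun_cong[OF sum0, of M] by (simp only: zero_fun_apply)
  then show ?thesis using coder_words_independent[OF A rep] by blast
qed

section \<open>Graded modules that are free over an enveloping algebra\<close>

text \<open>Common setting for the negative halves of both algebras. The degree will be minus the
  mode number, so only finitely many words stay below a given degree.\<close>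

locale graded_lie_module =
  fixes br :: "'g \<Rightarrow> 'g \<Rightarrow> ('g \<Rightarrow>\<^sub>0 complex)"
    and scale :: "complex \<Rightarrow> 'v \<Rightarrow> 'v::ab_group_add"
    and \<rho> :: "'g \<Rightarrow> 'v \<Rightarrow> 'v"
    and S :: "'g set"
    and deg :: "'g \<Rightarrow> int"
    and v :: 'v
  assumes lie: "lie_module br scale \<rho>"
    and closed: "\<And>x y z. x \<in> S \<Longrightarrow> y \<in> S \<Longrightarrow> z \<in> Poly_Mapping.keys (br x y) \<Longrightarrow> z \<in> S"
    and deg_bracket: "\<And>x y z. x \<in> S \<Longrightarrow> y \<in> S \<Longrightarrow> z \<in> Poly_Mapping.keys (br x y) \<Longrightarrow> deg z = deg x + deg y"
    and deg_pos: "\<And>x. x \<in> S \<Longrightarrow> deg x \<ge> 1"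
    and finite_deg: "\<And>e. finite {x \<in> S. deg x \<le> e}"
    and free: "free_over_uea br scale \<rho> S v"
begin

sublocale linear_operators scale \<rho>
  by (rule lie_module_linear_operators[OF lie])

abbreviation word_deg :: "'g list \<Rightarrow> int" where
  "word_deg w \<equiv> sum_list (map deg w)"

definition filt :: "int \<Rightarrow> 'v set" where
  "filt e = span {foldr \<rho> w v | w. w \<in> lists S \<and> word_deg w \<le> e}"

text \<open>The PBW filtration by length inside a degree bound: reordering a word costs only words
  with fewer letters.\<close>

definition short_filt :: "int \<Rightarrow> nat \<Rightarrow> 'v set" where
  "short_filt e l = span {foldr \<rho> w v | w. w \<in> lists S \<and> word_deg w \<le> e \<and> length w \<le> l}"

definition normal_index :: "int \<Rightarrow> 'g multiset set" where
  "normal_index e = {N. set_mset N \<subseteq> S \<and> (\<Sum>x\<in>#N. deg x) \<le> e}"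

lemma filt_mono: "e \<le> e' \<Longrightarrow> filt e \<subseteq> filt e'"
  unfolding filt_def by (intro span_mono) auto

lemma filt_word: "w \<in> lists S \<Longrightarrow> word_deg w \<le> e \<Longrightarrow> foldr \<rho> w v \<in> filt e"
  unfolding filt_def by (intro span_base) blast

lemma filt_op:
  assumes "x \<in> S" "u \<in> filt e" "e + deg x \<le> e'"
  shows "\<rho> x u \<in> filt e'"
  using assms(2) unfolding filt_def
proof (rule op_span[rotated])
  fix b assume "b \<in> {foldr \<rho> w v | w. w \<in> lists S \<and> word_deg w \<le> e}"
  then obtain w where "b = foldr \<rho> w v" "w \<in> lists S" "word_deg w \<le> e" by blast
  then show "\<rho> x b \<in> span {foldr \<rho> w v | w. w \<in> lists S \<and> word_deg w \<le> e'}"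
    using assms by (intro span_base CollectI exI[of _ "x # w"]) auto
qed

lemma ex_filt: "\<exists>e. u \<in> filt e"
proof -
  have "u \<in> span {foldr \<rho> w v | w. w \<in> lists S}"
    by (rule free_over_uea_span[OF vector_space_axioms free])
  then show ?thesis
  proof (induction rule: span_induct_alt)
    case (step c x y)
    then obtain w e where w: "w \<in> lists S" "x = foldr \<rho> w v" and e: "y \<in> filt e" by blast
    have "x \<in> filt (max e (word_deg w))" "y \<in> filt (max e (word_deg w))"
      using w e filt_word[of w "max e (word_deg w)"] filt_mono[of e "max e (word_deg w)"] by auto
    then have "scale c x + y \<in> filt (max e (word_deg w))"
      unfolding filt_def by (intro span_add span_scale)
    then show ?case by blast
  qed (auto simp: filt_def span_zero)
qed

section \<open>Reordering words modulo shorter words\<close>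

lemma short_filt_op:
  assumes "x \<in> S" "u \<in> short_filt e l"
  shows "\<rho> x u \<in> short_filt (e + deg x) (Suc l)"
  using assms(2) unfolding short_filt_def
proof (rule op_span[rotated])
  fix b assume "b \<in> {foldr \<rho> w v | w. w \<in> lists S \<and> word_deg w \<le> e \<and> length w \<le> l}"
  then obtain w where "b = foldr \<rho> w v" "w \<in> lists S" "word_deg w \<le> e" "length w \<le> l" by blast
  then show "\<rho> x b \<in> span {foldr \<rho> w v | w. w \<in> lists S \<and> word_deg w \<le> e + deg x \<and> length w \<le> Suc l}"
    using assms by (intro span_base CollectI exI[of _ "x # w"]) auto
qed

text \<open>The bracket replaces two letters by single letters of the same total degree, which saves
  one letter.\<close>

lemma swap_letters:
  assumes "x \<in> S" "y \<in> S" "t \<in> lists S" "word_deg (x # y # t) \<le> e" "Suc (length t) \<le> l"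
  shows "\<rho> x (\<rho> y (foldr \<rho> t v)) - \<rho> y (\<rho> x (foldr \<rho> t v)) \<in> short_filt e l"
  unfolding lie_module_bracket[OF lie] lin_ext_def short_filt_def
proof (intro span_sum span_scale span_base CollectI exI conjI)
  fix z assume z: "z \<in> Poly_Mapping.keys (br x y)"
  show "\<rho> z (foldr \<rho> t v) = foldr \<rho> (z # t) v" by simp
  show "z # t \<in> lists S" "word_deg (z # t) \<le> e" "length (z # t) \<le> l"
    using assms closed[OF _ _ z] deg_bracket[OF _ _ z] by auto
qed

lemma move_letter:
  assumes "x \<in> S" "us \<in> lists S" "vs \<in> lists S" "word_deg (x # us @ vs) \<le> e"
    "length us + length vs \<le> l"
  shows "foldr \<rho> (x # us @ vs) v - foldr \<rho> (us @ x # vs) v \<in> short_filt e l"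
  using assms
proof (induction us arbitrary: e l rule: list.induct)
  case Nil
  then show ?case by (simp add: short_filt_def span_zero)
next
  case (Cons y us)
  then obtain k where l: "l = Suc k" by (cases l) auto
  have y: "y \<in> S" and us: "us \<in> lists S" using Cons.prems by auto
  have "foldr \<rho> (x # us @ vs) v - foldr \<rho> (us @ x # vs) v \<in> short_filt (e - deg y) k"
    using Cons.prems y us l by (intro Cons.IH) auto
  from short_filt_op[OF y this]
  have 1: "\<rho> y (foldr \<rho> (x # us @ vs) v - foldr \<rho> (us @ x # vs) v) \<in> short_filt e l"
    by (simp add: l)
  have 2: "\<rho> x (\<rho> y (foldr \<rho> (us @ vs) v)) - \<rho> y (\<rho> x (foldr \<rho> (us @ vs) v)) \<in> short_filt e l"
    using Cons.prems y us l by (intro swap_letters) auto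
  from span_add[OF 1[unfolded short_filt_def] 2[unfolded short_filt_def]] show ?case
    by (simp add: short_filt_def op_diff)
qed

text \<open>The first letter of \<open>w\<close> is moved to the front of \<open>w'\<close>, then
  the tails are compared by induction. Each correction loses a letter, hence the bound
  \<open>l\<close> against \<open>Suc l\<close>.\<close>

lemma permute_word:
  assumes "mset w = mset w'" "w \<in> lists S" "word_deg w \<le> e" "length w \<le> Suc l"
  shows "foldr \<rho> w v - foldr \<rho> w' v \<in> short_filt e l"
  using assms
proof (induction w arbitrary: w' e l rule: list.induct)
  case Nil
  then show ?case by (simp add: short_filt_def span_zero)
next
  case (Cons x w)
  have "x \<in> set w'" using Cons.prems(1) by (metis list.set_intros(1) mset_eq_setD)
  then obtain us vs where w': "w' = us @ x # vs" by (meson split_list)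
  have m: "mset w = mset (us @ vs)" using Cons.prems(1) by (simp add: w')
  have x: "x \<in> S" and w: "w \<in> lists S" using Cons.prems by auto
  have uv: "us \<in> lists S" "vs \<in> lists S" using w mset_eq_setD[OF m] by auto
  have d: "word_deg w = word_deg (us @ vs)"
    using arg_cong[OF m, of "\<lambda>N. \<Sum>x\<in>#N. deg x"] by (simp add: sum_mset_sum_list flip: mset_map)
  have len: "length w = length us + length vs" using mset_eq_length[OF m] by simp
  have 2: "foldr \<rho> (x # us @ vs) v - foldr \<rho> (us @ x # vs) v \<in> short_filt e l"
    using Cons.prems x uv d len by (intro move_letter) auto
  show ?case
  \<comment> \<open>At \<open>l = 0\<close> both words are the same single letter. Otherwise the
    tails are compared one level lower, so that prefixing \<open>x\<close> lands in level
    \<open>l\<close>.\<close>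
  proof (cases l)
    case 0
    then show ?thesis using len Cons.prems by (simp add: w' short_filt_def span_zero)
  next
    case (Suc k)
    have "foldr \<rho> w v - foldr \<rho> (us @ vs) v \<in> short_filt (e - deg x) k"
      using Cons.prems w m Suc by (intro Cons.IH) auto
    from short_filt_op[OF x this]
    have 1: "\<rho> x (foldr \<rho> w v - foldr \<rho> (us @ vs) v) \<in> short_filt e l"
      by (simp add: Suc)
    from span_add[OF 1[unfolded short_filt_def] 2[unfolded short_filt_def]] show ?thesis
      by (simp add: short_filt_def op_diff w')
  qed
qed

text \<open>The easy half of PBW: by induction on length, each word equals the chosen ordering of
  its letters up to shorter words.\<close>

lemma filt_normal_words:
  assumes rep: "\<And>N. mset (rep N) = N"
  shows "filt e \<subseteq> span ((\<lambda>N. foldr \<rho> (rep N) v) ` normal_index e)"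
proof -
  let ?T = "span ((\<lambda>N. foldr \<rho> (rep N) v) ` normal_index e)"
  have normal: "foldr \<rho> (rep (mset w)) v \<in> ?T" if "w \<in> lists S" "word_deg w \<le> e" for w
    using that by (intro span_base imageI)
      (auto simp: normal_index_def sum_mset_sum_list simp flip: mset_map)
  have short: "short_filt e l \<subseteq> ?T" for l
  proof (induction l)
    case 0
    have "[] = rep {#}" using rep[of "{#}"] by simp
    then show ?case
      unfolding short_filt_def using normal[of "[]"] by (intro span_minimal) auto
  next
    case (Suc l)
    show ?case
      unfolding short_filt_def
    proof (intro span_minimal subsetI subspace_span)
      fix u assume "u \<in> {foldr \<rho> w v | w. w \<in> lists S \<and> word_deg w \<le> e \<and> length w \<le> Suc l}"
      then obtain w where w: "u = foldr \<rho> w v" "w \<in> lists S" "word_deg w \<le> e" "length w \<le> Suc l"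
        by blast
      have "foldr \<rho> w v - foldr \<rho> (rep (mset w)) v \<in> ?T"
        using permute_word[of w "rep (mset w)" e l] w rep Suc by auto
      from span_add[OF this normal[OF w(2,3)]] show "u \<in> ?T" by (simp add: w)
    qed
  qed
  show ?thesis
    unfolding filt_def
  proof (intro span_minimal subsetI subspace_span)
    fix u assume "u \<in> {foldr \<rho> w v | w. w \<in> lists S \<and> word_deg w \<le> e}"
    then obtain w where "u = foldr \<rho> w v" "w \<in> lists S" "word_deg w \<le> e" by blast
    then have "u \<in> short_filt e (length w)"
      unfolding short_filt_def by (intro span_base) blast
    then show "u \<in> ?T" using short by blast
  qed
qed

lemma length_le_word_deg: "w \<in> lists S \<Longrightarrow> int (length w) \<le> word_deg w"
  by (induction w rule: list.induct) (use deg_pos in force)+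

lemma deg_le_word_deg: "w \<in> lists S \<Longrightarrow> x \<in> set w \<Longrightarrow> deg x \<le> word_deg w"
proof (induction w rule: list.induct)
  case (Cons y w)
  then have "y \<in> S" "0 \<le> word_deg w" using length_le_word_deg[of w] by auto
  then show ?case using Cons deg_pos[of y] by force
qed simp

text \<open>Letters have degree at least one, so a degree bound \<open>e\<close> limits both the
  number of letters and the degree of each.\<close>

lemma finite_normal_index: "finite (normal_index e)"
proof (rule finite_subset)
  show "finite (mset ` {w. set w \<subseteq> {x \<in> S. deg x \<le> e} \<and> length w \<le> nat e})"
    by (intro finite_imageI finite_lists_length_le finite_deg)
  show "normal_index e \<subseteq> mset ` {w. set w \<subseteq> {x \<in> S. deg x \<le> e} \<and> length w \<le> nat e}"
  proof
    fix N assume N: "N \<in> normal_index e"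
    obtain w where w: "N = mset w" by (metis ex_mset)
    have "w \<in> lists S" "word_deg w \<le> e"
      using N by (auto simp: w normal_index_def sum_mset_sum_list simp flip: mset_map)
    then have "w \<in> {w. set w \<subseteq> {x \<in> S. deg x \<le> e} \<and> length w \<le> nat e}"
      using length_le_word_deg[of w] deg_le_word_deg[of w] by force
    then show "N \<in> mset ` {w. set w \<subseteq> {x \<in> S. deg x \<le> e} \<and> length w \<le> nat e}"
      unfolding w by (rule imageI)
  qed
qed

end

section \<open>Degrees of the negative modes in the two algebras\<close>

fun hv_deg :: "hv_basis \<Rightarrow> int" where
  "hv_deg (LH n) = - n" | "hv_deg (IH n) = - n" | "hv_deg _ = 0"

fun w22_deg :: "w22_basis \<Rightarrow> int" where
  "w22_deg (LW n) = - n" | "w22_deg (WW n) = - n" | "w22_deg _ = 0"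

lemma mem_w22_neg_iff: "x \<in> w22_neg \<longleftrightarrow> (\<exists>n<0. x = LW n \<or> x = WW n)"
proof
  assume "\<exists>n<0. x = LW n \<or> x = WW n"
  then obtain n where "n < 0" "x = LW n \<or> x = WW n" by blast
  then show "x \<in> w22_neg" by (auto simp: w22_neg_def intro!: exI[of _ "- n"])
next
  assume "x \<in> w22_neg"
  then obtain n where "n \<ge> 1" "x = LW (- n) \<or> x = WW (- n)" by (auto simp: w22_neg_def)
  then show "\<exists>n<0. x = LW n \<or> x = WW n" by (intro exI[of _ "- n"]) auto
qed

lemma hv_graded:
  assumes "hv_verma scale \<rho> v c\<^sub>L c\<^sub>I c\<^sub>L\<^sub>I h h\<^sub>I"
  shows "graded_lie_module hv_bracket scale \<rho> hv_neg hv_deg v"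
proof
  show "finite {x \<in> hv_neg. hv_deg x \<le> e}" for e
  proof (rule finite_subset)
    show "{x \<in> hv_neg. hv_deg x \<le> e} \<subseteq> LH ` {- e..0} \<union> IH ` {- e..0}"
      by (auto simp: mem_hv_neg_iff)
  qed auto
qed (use assms in \<open>auto simp: hv_verma_def mem_hv_neg_iff split: if_splits\<close>)

lemma w22_graded:
  assumes "w22_verma scale \<rho> v c\<^sub>L c\<^sub>W h h\<^sub>W"
  shows "graded_lie_module w22_bracket scale \<rho> w22_neg w22_deg v"
proof
  show "finite {x \<in> w22_neg. w22_deg x \<le> e}" for e
  proof (rule finite_subset)
    show "{x \<in> w22_neg. w22_deg x \<le> e} \<subseteq> LW ` {- e..0} \<union> WW ` {- e..0}"
      by (auto simp: mem_w22_neg_iff)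
  qed auto
qed (use assms in \<open>auto simp: w22_verma_def mem_w22_neg_iff split: if_splits\<close>)

section \<open>The filtration by degree and number of Heisenberg modes\<close>

locale hv_verma_module =
  fixes scale :: "complex \<Rightarrow> 'v \<Rightarrow> 'v::ab_group_add"
    and \<rho> :: "hv_basis \<Rightarrow> 'v \<Rightarrow> 'v"
    and v :: 'v
    and c\<^sub>L c\<^sub>L\<^sub>I h h\<^sub>I :: complex
  assumes verma: "hv_verma scale \<rho> v c\<^sub>L 0 c\<^sub>L\<^sub>I h h\<^sub>I"
begin

sublocale graded_lie_module hv_bracket scale \<rho> hv_neg hv_deg v
  by (rule hv_graded[OF verma])

abbreviation L :: "int \<Rightarrow> 'v \<Rightarrow> 'v" where "L n \<equiv> \<rho> (LH n)"
abbreviation I :: "int \<Rightarrow> 'v \<Rightarrow> 'v" where "I n \<equiv> \<rho> (IH n)"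

lemma central: "\<rho> CLH u = scale c\<^sub>L u" "\<rho> CIH u = 0" "\<rho> CLIH u = scale c\<^sub>L\<^sub>I u"
  using verma by (simp_all add: hv_verma_def)

lemma L_v: "n > 0 \<Longrightarrow> L n v = 0" and I_v: "n > 0 \<Longrightarrow> I n v = 0"
  and L_0_v: "L 0 v = scale h v" and I_0_v: "I 0 v = scale h\<^sub>I v"
  using verma by (simp_all add: hv_verma_def)

lemma I_I: "I n (I m u) = I m (I n u)"
  using lie_module_bracket[OF lie, of "IH n" "IH m" u] by (simp add: central split: if_splits)

lemma L_I: "L n (I m u) = I m (L n u) - scale (of_int m) (I (n + m) u)
    - (if n = - m then scale (of_int (n\<^sup>2 + n) * c\<^sub>L\<^sub>I) u else 0)"
  using lie_module_bracket[OF lie, of "LH n" "IH m" u]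
  by (auto simp: lin_ext_diff central algebra_simps split: if_splits)

text \<open>\<open>I 0\<close> commutes with all letters of \<open>hv_neg\<close>, so its scalar
  action on the generator \<open>v\<close> spreads to the whole module.\<close>

lemma I_0: "I 0 u = scale h\<^sub>I u"
proof -
  have words: "I 0 (foldr \<rho> w v) = scale h\<^sub>I (foldr \<rho> w v)" if "w \<in> lists hv_neg" for w
    using that
  proof (induction w rule: list.induct)
    case (Cons x w)
    then obtain n where "n < 0" "x = LH n \<or> x = IH n" by (auto simp: mem_hv_neg_iff)
    then show ?case
      using Cons L_I[of n 0 "foldr \<rho> w v"] I_I[of 0 n "foldr \<rho> w v"] by (auto simp: op_scale)
  qed (simp add: I_0_v)
  obtain e where "u \<in> filt e" using ex_filt by blast
  then show ?thesis
    unfolding filt_def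
  proof (induction rule: span_induct_alt)
    case (step c x y)
    then have "I 0 x = scale h\<^sub>I x" using words by blast
    then show ?case using step by (simp add: op_add op_scale scale_right_distrib mult.commute)
  qed simp
qed

definition num_I :: "hv_basis list \<Rightarrow> nat" where
  "num_I w = length (filter (\<lambda>x. \<exists>n. x = IH n) w)"

lemma num_I_simps [simp]:
  "num_I [] = 0" "num_I (LH n # w) = num_I w" "num_I (IH n # w) = Suc (num_I w)"
  by (simp_all add: num_I_def)

text \<open>Increasing in \<open>e\<close>, decreasing in \<open>q\<close>, and zero as soon as
  \<open>q\<close> exceeds \<open>e\<close>. This vanishing is what ends the triangular
  recursion.\<close>

definition I_filt :: "int \<Rightarrow> nat \<Rightarrow> 'v set" where
  "I_filt e q = span {foldr \<rho> w v | w. w \<in> lists hv_neg \<and> word_deg w \<le> e \<and> q \<le> num_I w}"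

lemma I_filt_0: "I_filt e 0 = filt e"
  by (simp add: I_filt_def filt_def)

lemma I_filt_mono: "e \<le> e' \<Longrightarrow> q' \<le> q \<Longrightarrow> I_filt e q \<subseteq> I_filt e' q'"
  unfolding I_filt_def by (intro span_mono) auto

lemma I_filt_word: "w \<in> lists hv_neg \<Longrightarrow> word_deg w \<le> e \<Longrightarrow> q \<le> num_I w \<Longrightarrow> foldr \<rho> w v \<in> I_filt e q"
  unfolding I_filt_def by (intro span_base) blast

lemma I_filt_trivial: "e < int q \<Longrightarrow> u \<in> I_filt e q \<Longrightarrow> u = 0"
proof -
  assume "e < int q" "u \<in> I_filt e q"
  have "False" if "w \<in> lists hv_neg" "word_deg w \<le> e" "q \<le> num_I w" for w
    using length_le_word_deg[OF that(1)] that \<open>e < int q\<close>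
      length_filter_le[of "\<lambda>x. \<exists>n. x = IH n" w] by (simp add: num_I_def)
  then have "{foldr \<rho> w v | w. w \<in> lists hv_neg \<and> word_deg w \<le> e \<and> q \<le> num_I w} = {}" by blast
  with \<open>u \<in> I_filt e q\<close> show "u = 0" by (simp add: I_filt_def)
qed

lemma L_I_filt: "n < 0 \<Longrightarrow> u \<in> I_filt e q \<Longrightarrow> L n u \<in> I_filt (e - n) q"
  unfolding I_filt_def
proof (rule op_span[rotated], assumption)
  fix b assume n: "n < 0"
    and "b \<in> {foldr \<rho> w v | w. w \<in> lists hv_neg \<and> word_deg w \<le> e \<and> q \<le> num_I w}"
  then obtain w where "b = foldr \<rho> w v" "w \<in> lists hv_neg" "word_deg w \<le> e" "q \<le> num_I w" by blast
  then show "L n b \<in> span {foldr \<rho> w v | w. w \<in> lists hv_neg \<and> word_deg w \<le> e - n \<and> q \<le> num_I w}"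
    using n by (intro span_base CollectI exI[of _ "LH n # w"]) (auto simp: mem_hv_neg_iff)
qed

lemma I_neg_I_filt: "n < 0 \<Longrightarrow> u \<in> I_filt e q \<Longrightarrow> I n u \<in> I_filt (e - n) (Suc q)"
  unfolding I_filt_def
proof (rule op_span[rotated], assumption)
  fix b assume n: "n < 0"
    and "b \<in> {foldr \<rho> w v | w. w \<in> lists hv_neg \<and> word_deg w \<le> e \<and> q \<le> num_I w}"
  then obtain w where "b = foldr \<rho> w v" "w \<in> lists hv_neg" "word_deg w \<le> e" "q \<le> num_I w" by blast
  then show "I n b \<in> span {foldr \<rho> w v | w. w \<in> lists hv_neg \<and> word_deg w \<le> e - n \<and> Suc q \<le> num_I w}"
    using n by (intro span_base CollectI exI[of _ "IH n # w"]) (auto simp: mem_hv_neg_iff)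
qed

text \<open>Moving \<open>I k\<close> to the right loses no I: it commutes with every
  \<open>I n\<close>, and its commutator with \<open>L n\<close> is an I mode plus a scalar that
  removes only the letter \<open>L n\<close>. At \<open>v\<close> it becomes zero, a scalar or a new
  letter.\<close>

lemma I_word_I_filt:
  assumes "w \<in> lists hv_neg" "word_deg w \<le> e" "q \<le> num_I w"
  shows "I k (foldr \<rho> w v) \<in> I_filt (e - k) q"
  using assms
proof (induction w arbitrary: e q k rule: list.induct)
  case Nil
  consider "k > 0" | "k = 0" | "k < 0" by linarith
  then show ?case
  proof cases
    case 1
    then show ?thesis by (simp add: I_v I_filt_def span_zero)
  next
    case 2
    then show ?thesis using I_filt_word[OF Nil] by (simp add: I_0_v I_filt_def span_scale)
  next
    case 3
    then show ?thesis using Nil I_filt_word[of "[IH k]" "e - k" q] by (simp add: mem_hv_neg_iff)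
  qed
next
  case (Cons x w)
  have w: "w \<in> lists hv_neg" using Cons.prems by simp
  obtain n where n: "n < 0" "x = LH n \<or> x = IH n" using Cons.prems by (auto simp: mem_hv_neg_iff)
  from n(2) show ?case
  proof
    assume x: "x = IH n"
    \<comment> \<open>At \<open>q = 0\<close> the subtraction truncates; prefixing
      \<open>I n\<close> then gives one I more than required, which \<open>I_filt_mono\<close>
      discards.\<close>
    have "I k (foldr \<rho> w v) \<in> I_filt (e + n - k) (q - 1)"
      using Cons.prems x by (intro Cons.IH) auto
    from I_neg_I_filt[OF n(1) this] have "I n (I k (foldr \<rho> w v)) \<in> I_filt (e - k) q"
      using I_filt_mono[of "e + n - k - n" "e - k" q "Suc (q - 1)", THEN subsetD] by simp
    then show ?thesis by (simp add: x I_I[of k])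
  next
    assume x: "x = LH n"
    have deg: "word_deg w \<le> e + n" and q: "q \<le> num_I w" using Cons.prems x by auto
    have 1: "L n (I k (foldr \<rho> w v)) \<in> I_filt (e - k) q"
      using L_I_filt[OF n(1) Cons.IH[OF w deg q, of k]] by (simp add: algebra_simps)
    have 2: "I (n + k) (foldr \<rho> w v) \<in> I_filt (e - k) q"
      using Cons.IH[OF w deg q, of "n + k"] by (simp add: algebra_simps)
    have 3: "foldr \<rho> w v \<in> I_filt (e - k) q" if "n = - k"
      using I_filt_word[OF w deg q] that by simp
    have "I k (foldr \<rho> (x # w) v) = L n (I k (foldr \<rho> w v)) + scale (of_int k) (I (n + k) (foldr \<rho> w v))
      + (if n = - k then scale (of_int (n\<^sup>2 + n) * c\<^sub>L\<^sub>I) (foldr \<rho> w v) else 0)"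
      using L_I[of n k "foldr \<rho> w v"] by (simp add: x)
    also have "\<dots> \<in> I_filt (e - k) q"
      using 1 2 3 unfolding I_filt_def by (auto intro!: span_add span_scale span_zero)
    finally show ?thesis .
  qed
qed

lemma I_I_filt:
  assumes "u \<in> I_filt e q"
  shows "I k u \<in> I_filt (e - k) q"
proof -
  have "I k b \<in> span {foldr \<rho> w v | w. w \<in> lists hv_neg \<and> word_deg w \<le> e - k \<and> q \<le> num_I w}"
    if "b \<in> {foldr \<rho> w v | w. w \<in> lists hv_neg \<and> word_deg w \<le> e \<and> q \<le> num_I w}" for b
    using that I_word_I_filt[unfolded I_filt_def] by blast
  then show ?thesis
    using assms unfolding I_filt_def by (rule op_span)
qed

lemma I_large: "u \<in> I_filt e q \<Longrightarrow> k > e \<Longrightarrow> I k u = 0"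
  by (rule I_filt_trivial[OF _ I_I_filt[of u e q k]]) auto

section \<open>Triangularity of the modes W(-n)\<close>

lemma normal_ordered_II_eq: "normal_ordered_II \<rho> k m u = I k (I m u)"
  by (simp add: normal_ordered_II_def I_I)

text \<open>The diagonal part has two sources: the summands k = 0 and k = -n each give h_I I(-n),
  and the derivative term gives 2 c (n - 1) I(-n).\<close>

lemma W_mode_neg:
  assumes "n \<ge> 1" "u \<in> I_filt e q"
  obtains K where "finite K" "0 \<notin> K" "- n \<notin> K"
    "W_mode scale \<rho> c (- n) u = scale (2 * h\<^sub>I + 2 * c * of_int (n - 1)) (I (- n) u)
       + (\<Sum>k\<in>K. I k (I (- n - k) u))"
proof
  \<comment> \<open>The absolute value keeps 0 and -n inside the interval for every sign of
    \<open>e\<close>, so both can be split off.\<close>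
  let ?K = "{- n - \<bar>e\<bar>..\<bar>e\<bar>}" and ?f = "\<lambda>k. I k (I (- n - k) u)"
  have "?f k = 0" if "k \<notin> ?K" for k
  proof -
    have "k > e \<or> - n - k > e" using that by auto
    then show ?thesis
    proof
      assume "k > e"
      then show ?thesis using I_large[OF assms(2)] by (subst I_I) simp
    next
      assume "- n - k > e"
      then show ?thesis using I_large[OF assms(2)] by simp
    qed
  qed
  then have "{k. ?f k \<noteq> 0} \<subseteq> ?K" by blast
  then have "Sum_any ?f = sum ?f ?K"
    by (intro Sum_any.expand_superset) auto
  also have "\<dots> = ?f 0 + (?f (- n) + sum ?f (?K - {0} - {- n}))"
    using assms(1) by (subst sum.remove[of _ 0], simp, simp, subst sum.remove[of _ "- n"]) auto
  finally show "W_mode scale \<rho> c (- n) u = scale (2 * h\<^sub>I + 2 * c * of_int (n - 1)) (I (- n) u)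
       + sum ?f (?K - {0} - {- n})"
    by (simp add: W_mode_def normal_ordered_II_eq I_0 op_scale algebra_simps flip: scale_left_distrib)
  show "finite (?K - {0} - {- n})" "0 \<notin> ?K - {0} - {- n}" "- n \<notin> ?K - {0} - {- n}" by auto
qed

text \<open>\<open>M e\<close> will be the image of a degree-bounded piece under \<Psi>. Solving the
  W(-n) formula for its diagonal term shows that closure under W(-n) forces closure under
  I(-n).\<close>

lemma filt_subset_if_closed:
  assumes nonzero: "\<And>n. n \<ge> 1 \<Longrightarrow> 2 * h\<^sub>I + 2 * c * of_int (n - 1) \<noteq> 0"
    and sub: "\<And>e. subspace (M e)" and mono: "\<And>e e'. e \<le> e' \<Longrightarrow> M e \<subseteq> M e'"
    and v: "v \<in> M 0"
    and L: "\<And>e n u. n < 0 \<Longrightarrow> u \<in> M e \<Longrightarrow> L n u \<in> M (e - n)"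
    and W: "\<And>e n u. n < 0 \<Longrightarrow> u \<in> M e \<Longrightarrow> W_mode scale \<rho> c n u \<in> M (e - n)"
  shows "filt e \<subseteq> M e"
proof (induction "nat e" arbitrary: e rule: less_induct)
  case less
  have IH: "filt (e - n) \<subseteq> M (e - n)" if "n \<ge> 1" "n \<le> e" for n
    using that by (intro less) auto
  \<comment> \<open>Descending induction on \<open>q\<close>, and for fixed \<open>q\<close> on
    \<open>n\<close>: an off-diagonal term either has one more I inside or a lower mode outside.
    Both parameters are bounded, since \<open>u = 0\<close> once \<open>e - n < q\<close>.\<close>
  have I_M: "I (- n) u \<in> M e" if "u \<in> I_filt (e - n) q" "n \<ge> 1" for u n q
    using that
  proof (induction "nat (e + 1 - int q)" arbitrary: q n u rule: less_induct)
    case outer: less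
    from outer.prems show ?case
    proof (induction "nat (e + 1 - n)" arbitrary: n u rule: less_induct)
      case inner: less
      show ?case
      proof (cases "e - n < int q")
        case True
        then have "u = 0" using I_filt_trivial inner.prems by blast
        then show ?thesis using subspace_0[OF sub] by simp
      next
        case False
        obtain K where K: "finite K" "0 \<notin> K" "- n \<notin> K" and
          eq: "W_mode scale \<rho> c (- n) u = scale (2 * h\<^sub>I + 2 * c * of_int (n - 1)) (I (- n) u)
            + (\<Sum>k\<in>K. I k (I (- n - k) u))"
          using W_mode_neg[OF inner.prems(2,1)] by blast
        \<comment> \<open>If one factor has positive mode \<open>j\<close>, the other has mode -(n +
          j); applying \<open>I j\<close> first leaves a vector of lower degree, so the inner
          induction applies.\<close>
        have raise: "I (- (n + j)) (I j u) \<in> M e" if "j > 0" for j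
          using I_I_filt[OF inner.prems(1), of j] that False inner.prems(2)
          by (intro inner.hyps) (auto simp: algebra_simps)
        have "I k (I (- n - k) u) \<in> M e" if "k \<in> K" for k
        proof -
          have "k \<noteq> 0" "k \<noteq> - n" using that K by auto
          then consider "k > 0" | "k < - n" | "- n < k" "k < 0" by linarith
          then show ?thesis
          proof cases
            case 1
            then show ?thesis using raise[of k] by (simp add: I_I[of k])
          next
            case 2
            then show ?thesis using raise[of "- n - k"] by simp
          next
            case 3
            \<comment> \<open>Both modes are negative, so the inner factor adds an I and the outer
              one falls under the induction on \<open>q\<close>.\<close>
            have "I (- n - k) u \<in> I_filt (e - (- k)) (Suc q)"
              using I_neg_I_filt[OF _ inner.prems(1), of "- n - k"] 3 by simp
            then have "I (- (- k)) (I (- n - k) u) \<in> M e"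
              using False inner.prems(2) 3 by (intro outer.hyps) auto
            then show ?thesis by simp
          qed
        qed
        then have rest: "(\<Sum>k\<in>K. I k (I (- n - k) u)) \<in> M e"
          by (intro subspace_sum[OF sub])
        have "u \<in> filt (e - n)"
          using inner.prems(1) I_filt_mono[of "e - n" "e - n" 0 q] by (auto simp: I_filt_0)
        \<comment> \<open>The induction on \<open>e\<close> enters here: \<open>u\<close> has degree
          strictly below \<open>e\<close>, so W(-n) may be applied inside \<open>M\<close>.\<close>
        then have "u \<in> M (e - n)" using IH[of n] False inner.prems(2) by auto
        from W[OF _ this, of "- n"] have "W_mode scale \<rho> c (- n) u \<in> M e"
          using inner.prems(2) by simp
        from subspace_diff[OF sub this rest]
        have "scale (2 * h\<^sub>I + 2 * c * of_int (n - 1)) (I (- n) u) \<in> M e" by (simp only: eq add_diff_cancel_right')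
        from subspace_scale[OF sub this, of "1 / (2 * h\<^sub>I + 2 * c * of_int (n - 1))"]
        show ?thesis using nonzero[OF inner.prems(2)] by simp
      qed
    qed
  qed
  show ?case
    unfolding filt_def
  proof (intro span_minimal subsetI sub)
    fix u assume "u \<in> {foldr \<rho> w v | w. w \<in> lists hv_neg \<and> word_deg w \<le> e}"
    then obtain w where w: "u = foldr \<rho> w v" "w \<in> lists hv_neg" "word_deg w \<le> e" by blast
    have e: "e \<ge> 0" using length_le_word_deg[OF w(2)] w(3) by linarith
    show "u \<in> M e"
    proof (cases w)
      case Nil
      then show ?thesis using v mono[OF e] w by auto
    next
      case (Cons x t)
      have t: "t \<in> lists hv_neg" using w Cons by simp
      obtain n where n: "n < 0" "x = LH n \<or> x = IH n" using w Cons by (auto simp: mem_hv_neg_iff)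
      have deg: "word_deg t \<le> e + n" using w n Cons by auto
      have tf: "foldr \<rho> t v \<in> filt (e - (- n))" using filt_word[OF t deg] by simp
      from n(2) show ?thesis
      proof
        assume "x = IH n"
        then show ?thesis using I_M[of _ "- n" 0] tf n(1) by (simp add: w Cons I_filt_0)
      next
        assume x: "x = LH n"
        have "- n \<le> e" using length_le_word_deg[OF t] deg by linarith
        then have "foldr \<rho> t v \<in> M (e - (- n))" using tf IH[of "- n"] n(1) by auto
        from L[OF n(1) this] show ?thesis by (simp add: w Cons x)
      qed
    qed
  qed
qed

end

section \<open>Bijectivity\<close>

lemma (in lin_space) span_image_sum:
  assumes "finite A" "u \<in> span (f ` A)"
  shows "\<exists>c. u = (\<Sum>a\<in>A. scale (c a) (f a))"
  using assms(2)
proof (induction rule: span_induct_alt)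
  case base
  show ?case by (rule exI[of _ "\<lambda>_. 0"]) simp
next
  case (step r x y)
  then obtain a c where a: "a \<in> A" "x = f a" and y: "y = (\<Sum>a\<in>A. scale (c a) (f a))" by auto
  have "(\<Sum>b\<in>A. scale ((c(a := c a + r)) b) (f b)) = scale r x + y"
    using assms(1) a by (simp add: y sum.remove scale_left_distrib)
  then show ?case by metis
qed

text \<open>A degree-preserving relabelling of letters, not a Lie algebra homomorphism; it matches
  the index sets of the two word families.\<close>

fun hv_of_w22 :: "w22_basis \<Rightarrow> hv_basis" where
  "hv_of_w22 (LW n) = LH n" | "hv_of_w22 (WW n) = IH n"
| "hv_of_w22 CW = CLH" | "hv_of_w22 CWW = CIH"

lemma inj_hv_of_w22: "inj hv_of_w22"
proof (rule injI)
  show "x = y" if "hv_of_w22 x = hv_of_w22 y" for x y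
    using that by (cases x; cases y) auto
qed

context hv_verma_module
begin

text \<open>Surjectivity is proved separately for each degree bound because the dimension count for
  injectivity takes place inside one bounded piece.\<close>

lemma bij_w22_hom:
  fixes scaleW :: "complex \<Rightarrow> 'w \<Rightarrow> 'w::ab_group_add"
  assumes w22: "w22_verma scaleW actW vW c\<^sub>L' c\<^sub>W h' h\<^sub>W"
    and hom: "lie_module_hom scaleW scale actW (w22_act_on_hv scale \<rho> c\<^sub>L' c\<^sub>W c) \<Psi>"
    and \<Psi>_v: "\<Psi> vW = v"
    and nonzero: "\<And>n. n \<ge> 1 \<Longrightarrow> 2 * h\<^sub>I + 2 * c * of_int (n - 1) \<noteq> 0"
  shows "bij \<Psi>"
proof -
  interpret W: graded_lie_module w22_bracket scaleW actW w22_neg w22_deg vW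
    by (rule w22_graded[OF w22])
  interpret \<Psi>: Vector_Spaces.linear scaleW scale \<Psi>
    using hom by (simp add: lie_module_hom_def)
  have act: "\<Psi> (actW x u) = w22_act_on_hv scale \<rho> c\<^sub>L' c\<^sub>W c x (\<Psi> u)" for x u
    using hom by (simp add: lie_module_hom_def)
  have surj_filt: "filt e \<subseteq> \<Psi> ` W.filt e" for e
  proof (rule filt_subset_if_closed[OF nonzero])
    show "subspace (\<Psi> ` W.filt e)" for e
      unfolding W.filt_def by (intro \<Psi>.subspace_image W.subspace_span)
    show "\<Psi> ` W.filt e \<subseteq> \<Psi> ` W.filt e'" if "e \<le> e'" for e e'
      using W.filt_mono[OF that] by blast
    show "v \<in> \<Psi> ` W.filt 0"
      using W.filt_word[of "[]" 0] \<Psi>_v by force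
    show "L n u \<in> \<Psi> ` W.filt (e - n)" if n: "n < 0" and u: "u \<in> \<Psi> ` W.filt e" for e n u
    proof -
      obtain u' where u': "u = \<Psi> u'" "u' \<in> W.filt e" using u by blast
      have "actW (LW n) u' \<in> W.filt (e - n)"
        using n by (intro W.filt_op[OF _ u'(2)]) (auto simp: mem_w22_neg_iff)
      then have "\<Psi> (actW (LW n) u') \<in> \<Psi> ` W.filt (e - n)" by (rule imageI)
      then show ?thesis by (simp add: act u'(1))
    qed
    show "W_mode scale \<rho> c n u \<in> \<Psi> ` W.filt (e - n)" if n: "n < 0" and u: "u \<in> \<Psi> ` W.filt e" for e n u
    proof -
      obtain u' where u': "u = \<Psi> u'" "u' \<in> W.filt e" using u by blast
      have "actW (WW n) u' \<in> W.filt (e - n)"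
        using n by (intro W.filt_op[OF _ u'(2)]) (auto simp: mem_w22_neg_iff)
      then have "\<Psi> (actW (WW n) u') \<in> \<Psi> ` W.filt (e - n)" by (rule imageI)
      then show ?thesis by (simp add: act u'(1))
    qed
  qed
  define rep :: "w22_basis multiset \<Rightarrow> w22_basis list" where "rep N = (SOME w. mset w = N)" for N
  have rep: "mset (rep N) = N" for N
    unfolding rep_def by (rule someI_ex) (rule ex_mset)
  have ker_filt: "u = 0" if "u \<in> W.filt e" "\<Psi> u = 0" for u e
  proof -
    define A where "A = W.normal_index e"
    define f where "f N = foldr actW (rep N) vW" for N
    define word where "word N = map hv_of_w22 (rep N)" for N
    have fin: "finite A" unfolding A_def by (rule W.finite_normal_index)
    have mset_word: "mset (word N) = image_mset hv_of_w22 N" for N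
      by (simp add: word_def rep)
    have word_neg: "word N \<in> lists hv_neg \<and> word_deg (word N) \<le> e" if "N \<in> A" for N
    proof -
      have "set (rep N) = set_mset N" by (metis rep set_mset_mset)
      then have neg: "set (rep N) \<subseteq> w22_neg" using that by (simp add: A_def W.normal_index_def)
      have "(\<Sum>x\<in>#mset (rep N). w22_deg x) \<le> e" using that by (simp add: rep A_def W.normal_index_def)
      then have "W.word_deg (rep N) \<le> e" by (simp add: sum_mset_sum_list flip: mset_map)
      moreover have "hv_deg (hv_of_w22 x) = w22_deg x" for x by (cases x) auto
      moreover have "hv_of_w22 x \<in> hv_neg" if "x \<in> w22_neg" for x
        using that by (auto simp: mem_w22_neg_iff mem_hv_neg_iff)
      then have "word N \<in> lists hv_neg"
        using neg by (fastforce simp: word_def)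
      ultimately show ?thesis by (simp add: word_def comp_def)
    qed
    have inj: "inj_on (\<lambda>N. mset (word N)) A"
      unfolding mset_word by (rule inj_on_subset[OF multiset.inj_map[OF inj_hv_of_w22]]) simp
    have indep: "\<forall>N\<in>A. b N = 0" if b: "(\<Sum>N\<in>A. scale (b N) (foldr \<rho> (word N) v)) = 0" for b
    proof -
      \<comment> \<open>The independence result is indexed by multisets of Heisenberg-Virasoro
        letters, the coefficients by W(2,2) multisets; \<open>inv_word\<close> translates
        back.\<close>
      define inv_word where "inv_word = inv_into A (\<lambda>N. mset (word N))"
      have inv: "inv_word (mset (word N)) = N" if "N \<in> A" for N
        unfolding inv_word_def using inj that by (rule inv_into_f_f)
      have "\<forall>N\<in>(\<lambda>N. mset (word N)) ` A. b (inv_word N) = 0"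
      proof (rule hv_words_independent[OF lie free])
        show "(\<Sum>N\<in>(\<lambda>N. mset (word N)) ` A. scale (b (inv_word N)) (foldr \<rho> (word (inv_word N)) v)) = 0"
          using b by (simp add: sum.reindex[OF inj] inv)
      next
        show "set_mset N \<subseteq> hv_neg" if "N \<in> (\<lambda>N. mset (word N)) ` A" for N
          using that word_neg by fastforce
      qed (use fin inv in auto)
      then show ?thesis using inv by auto
    qed
    \<comment> \<open>By surjectivity the independent Heisenberg words lie in the span of the
      equally many images \<open>\<Psi> (f N)\<close>, which the exchange lemma then makes
      independent.\<close>
    have sp: "foldr \<rho> (word N) v \<in> span ((\<lambda>N. \<Psi> (f N)) ` A)" if "N \<in> A" for N
    proof -
      have "foldr \<rho> (word N) v \<in> \<Psi> ` W.filt e"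
        using surj_filt filt_word word_neg[OF that] by blast
      also have "\<dots> \<subseteq> \<Psi> ` W.span (f ` A)"
        unfolding f_def A_def by (intro image_mono W.filt_normal_words rep)
      also have "\<dots> = span ((\<lambda>N. \<Psi> (f N)) ` A)"
        by (simp only: \<Psi>.span_image[symmetric] image_image)
      finally show ?thesis .
    qed
    obtain b where b: "u = (\<Sum>N\<in>A. scaleW (b N) (f N))"
      using W.span_image_sum[OF fin, of u f] W.filt_normal_words[OF rep, of e] \<open>u \<in> W.filt e\<close>
      unfolding f_def A_def by blast
    have "(\<Sum>N\<in>A. scale (b N) (\<Psi> (f N))) = 0"
      using \<open>\<Psi> u = 0\<close> by (simp add: b \<Psi>.sum \<Psi>.scale)
    from independent_family_if_spans_independent_family[OF fin indep sp this]
    show "u = 0" by (simp add: b)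
  qed
  show ?thesis
  proof (rule bijI)
    show "inj \<Psi>"
    proof (rule injI)
      fix x y assume "\<Psi> x = \<Psi> y"
      then have "\<Psi> (x - y) = 0" by (simp add: \<Psi>.diff)
      moreover obtain e where "x - y \<in> W.filt e" using W.ex_filt by blast
      ultimately have "x - y = 0" by (intro ker_filt)
      then show "x = y" by simp
    qed
    show "surj \<Psi>"
    proof (unfold surj_def, rule allI)
      fix y
      obtain e where "y \<in> filt e" using ex_filt by blast
      then show "\<exists>x. y = \<Psi> x" using surj_filt by blast
    qed
  qed
qed

end

section \<open>The Schur polynomial vectors\<close>

lemma poly_exp_series_deriv: "fps_deriv poly_exp_series = poly_exp_series"
proof (rule fps_ext)
  fix n
  have "(of_nat (Suc n) :: cpoly) * poly_const (1 / fact (Suc n)) = poly_const (1 / fact n)"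
    unfolding poly_const_def single_of_nat[symmetric] mult_single
    by (simp del: of_nat_Suc single_of_nat add: field_simps)
  then show "fps_nth (fps_deriv poly_exp_series) n = fps_nth poly_exp_series n"
    by (simp add: poly_exp_series_def del: of_nat_Suc fact_Suc)
qed

lemma schur_poly_0: "schur_poly 0 = 1"
  by (simp add: schur_poly_def poly_exp_series_def poly_const_def)

lemma schur_exponent_deriv: "fps_nth (fps_deriv schur_exponent) n = poly_var (Suc n)"
proof -
  have "(of_nat (Suc n) :: cpoly) * poly_const (1 / of_nat (Suc n)) = 1"
    unfolding poly_const_def single_of_nat[symmetric] mult_single
    by (simp del: of_nat_Suc single_of_nat)
  then show ?thesis
    by (simp add: schur_exponent_def del: of_nat_Suc flip: mult.assoc)
qed

text \<open>Differentiating \<open>exp(\<Sum> x\<^sub>n y\<^sup>n / n)\<close> in \<open>y\<close>.\<close>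

lemma schur_poly_Suc:
  "of_nat (Suc r) * schur_poly (Suc r) = (\<Sum>i\<le>r. poly_var (Suc r - i) * schur_poly i)"
proof -
  have "fps_nth (fps_deriv (poly_exp_series oo schur_exponent)) r =
      fps_nth ((poly_exp_series oo schur_exponent) * fps_deriv schur_exponent) r"
    by (subst fps_compose_deriv) (simp_all add: poly_exp_series_deriv schur_exponent_def)
  also have "\<dots> = (\<Sum>i=0..r. schur_poly i * poly_var (Suc (r - i)))"
    by (simp only: fps_mult_nth schur_exponent_deriv schur_poly_def)
  also have "\<dots> = (\<Sum>i\<le>r. poly_var (Suc r - i) * schur_poly i)"
    unfolding atMost_atLeast0 by (intro sum.cong) (auto simp: Suc_diff_le mult.commute)
  finally show ?thesis by (simp add: schur_poly_def del: of_nat_Suc)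
qed

section \<open>Monomials in commuting operators\<close>

lemma foldr_funpow_increment:
  assumes comm: "\<And>i j u. A i (A j u) = A j (A i u)"
    and "distinct ns" "k \<in> set ns"
  shows "foldr (\<lambda>n. A n ^^ (f(k := Suc (f k))) n) ns u = A k (foldr (\<lambda>n. A n ^^ f n) ns u)"
  using assms(2,3)
proof (induction ns)
  case (Cons n ns)
  have pow: "(A n ^^ j) (A k w) = A k ((A n ^^ j) w)" for j w
    by (induction j) (simp_all add: comm)
  show ?case
  proof (cases "n = k")
    case True
    then have "k \<notin> set ns" using Cons.prems by simp
    then have "foldr (\<lambda>n. A n ^^ (f(k := Suc (f k))) n) ns u = foldr (\<lambda>n. A n ^^ f n) ns u"
      by (intro foldr_cong) auto
    then show ?thesis using True by simp
  next
    case False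
    then show ?thesis using Cons by (simp add: pow)
  qed
qed simp

text \<open>Exponent zero acts as the identity, so monomials with different supports can be compared
  over one common list of indices.\<close>

lemma monomial_act_upt:
  assumes "\<And>n. n \<in> Poly_Mapping.keys m \<Longrightarrow> n < N"
  shows "monomial_act A m u = foldr (\<lambda>n. A n ^^ Poly_Mapping.lookup m n) [0..<N] u"
proof -
  have "sorted_list_of_set (Poly_Mapping.keys m) = filter (\<lambda>n. n \<in> Poly_Mapping.keys m) [0..<N]"
    using assms by (intro sorted_distinct_set_unique) (auto simp: sorted_wrt_filter)
  moreover have "foldr (\<lambda>n. A n ^^ Poly_Mapping.lookup m n) (filter (\<lambda>n. n \<in> Poly_Mapping.keys m) ns) u =
      foldr (\<lambda>n. A n ^^ Poly_Mapping.lookup m n) ns u" for ns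
    by (induction ns) (auto simp: in_keys_iff)
  ultimately show ?thesis by (simp add: monomial_act_def)
qed

lemma monomial_act_var:
  assumes comm: "\<And>i j u. A i (A j u) = A j (A i u)"
  shows "monomial_act A (Poly_Mapping.single k 1 + m) u = A k (monomial_act A m u)"
proof -
  define N where "N = Suc (Max (insert k (Poly_Mapping.keys m)))"
  have N: "n < N" if "n = k \<or> n \<in> Poly_Mapping.keys m" for n
    using that by (auto simp: N_def less_Suc_eq_le intro!: Max_ge)
  have "monomial_act A (Poly_Mapping.single k 1 + m) u =
     foldr (\<lambda>n. A n ^^ Poly_Mapping.lookup (Poly_Mapping.single k 1 + m) n) [0..<N] u"
    using N Poly_Mapping.keys_add[of "Poly_Mapping.single k 1" m]
    by (intro monomial_act_upt) auto
  also have "Poly_Mapping.lookup (Poly_Mapping.single k 1 + m) =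
     (Poly_Mapping.lookup m)(k := Suc (Poly_Mapping.lookup m k))"
    by (auto simp: fun_eq_iff lookup_add lookup_single)
  also have "foldr (\<lambda>n. A n ^^ \<dots> n) [0..<N] u =
      A k (foldr (\<lambda>n. A n ^^ Poly_Mapping.lookup m n) [0..<N] u)"
    using N by (intro foldr_funpow_increment comm) auto
  also have "foldr (\<lambda>n. A n ^^ Poly_Mapping.lookup m n) [0..<N] u = monomial_act A m u"
    using N by (intro monomial_act_upt[symmetric]) auto
  finally show ?thesis .
qed

lemma poly_mapping_sum_single:
  "(\<Sum>m\<in>Poly_Mapping.keys P. Poly_Mapping.single m (Poly_Mapping.lookup P m)) = P"
  by (rule poly_mapping_eqI)
    (simp add: lookup_sum lookup_single when_def sum.delta in_keys_iff)

context lin_space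
begin

lemma lin_ext_single_times:
  "lin_ext f (Poly_Mapping.single k 1 * P) = lin_ext (\<lambda>m. f (k + m)) P"
proof -
  have "Poly_Mapping.single k 1 * P =
      (\<Sum>m\<in>Poly_Mapping.keys P. Poly_Mapping.single (k + m) (Poly_Mapping.lookup P m))"
    by (subst (1) poly_mapping_sum_single[symmetric]) (simp add: sum_distrib_left mult_single)
  then show ?thesis
    by (simp add: lin_ext_sum) (simp add: lin_ext_def)
qed

lemma lin_ext_of_nat_times: "lin_ext f (of_nat n * P) = scale (of_nat n) (lin_ext f P)"
  by (induction n) (simp_all add: distrib_right lin_ext_add scale_left_distrib)

end

section \<open>The vectors s_r and the modes acting on them\<close>

context hv_verma_module
begin

abbreviation X :: "nat \<Rightarrow> 'v \<Rightarrow> 'v" where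
  "X n u \<equiv> scale (- 1 / c\<^sub>L\<^sub>I) (I (- int n) u)"

definition schur_vector :: "nat \<Rightarrow> 'v" where
  "schur_vector r = poly_act scale X (schur_poly r) v"

lemma X_X: "X i (X j u) = X j (X i u)"
  by (simp add: op_scale op_neg I_I[of "- int i"])

lemma X_add: "X i (u + w) = X i u + X i w"
  by (simp add: op_add scale_right_distrib op_neg)

lemma X_scale: "X i (scale c u) = scale c (X i u)"
  by (simp add: op_scale op_neg mult.commute)

lemma X_sum: "X i (sum f A) = (\<Sum>a\<in>A. X i (f a))"
  by (simp add: op_sum op_neg scale_sum_right sum_negf)

lemma schur_vector_0: "schur_vector 0 = v"
proof -
  have "poly_act scale X 1 v = poly_act scale X (Poly_Mapping.single 0 1) v" by simp
  also have "\<dots> = v"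
    by (subst poly_act_eq[OF vector_space_axioms]) (simp add: monomial_act_def del: single_one)
  finally show ?thesis by (simp add: schur_vector_def schur_poly_0)
qed

lemma schur_vector_Suc:
  "scale (of_nat (Suc r)) (schur_vector (Suc r)) = (\<Sum>i\<le>r. X (Suc r - i) (schur_vector i))"
proof -
  have mult: "lin_ext (\<lambda>m. monomial_act X m v) (poly_var k * P) =
      X k (lin_ext (\<lambda>m. monomial_act X m v) P)" for k P
  proof -
    have "monomial_act X (Poly_Mapping.single k 1 + m) v = X k (monomial_act X m v)" for m
      by (rule monomial_act_var[where A = X]) (rule X_X)
    then show ?thesis
      unfolding poly_var_def lin_ext_single_times
      by (simp only: lin_ext_def X_sum X_scale)
  qed
  have "scale (of_nat (Suc r)) (schur_vector (Suc r)) =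
      lin_ext (\<lambda>m. monomial_act X m v) (of_nat (Suc r) * schur_poly (Suc r))"
    by (simp only: schur_vector_def poly_act_eq[OF vector_space_axioms] lin_ext_of_nat_times)
  also have "\<dots> = (\<Sum>i\<le>r. X (Suc r - i) (schur_vector i))"
    by (simp only: schur_poly_Suc lin_ext_sum mult schur_vector_def poly_act_eq[OF vector_space_axioms])
  finally show ?thesis .
qed

text \<open>Induction shaped like the recursion, which expresses (r + 1) s_(r+1) through all s_i
  with i \<le> r.\<close>

lemma nat_Suc_strong_induct:
  assumes "Q 0"
    and "\<And>r. (\<And>i. i \<le> r \<Longrightarrow> Q i) \<Longrightarrow> Q (Suc r)"
  shows "Q (r :: nat)"
  using assms by (induction r rule: less_induct) (metis less_Suc_eq_le not0_implies_Suc)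

lemma scale_Suc_cancel: "scale (of_nat (Suc r)) u = scale (of_nat (Suc r)) w \<Longrightarrow> u = w"
  using scale_cancel_left[of "of_nat (Suc r)" u w] by (metis of_nat_eq_0_iff nat.distinct(1))

lemma I_schur_vector: "k > 0 \<Longrightarrow> I k (schur_vector r) = 0"
proof (induction r rule: nat_Suc_strong_induct)
  case 1
  then show ?case by (simp add: schur_vector_0 I_v)
next
  case (2 r)
  have "scale (of_nat (Suc r)) (I k (schur_vector (Suc r))) =
      I k (\<Sum>i\<le>r. X (Suc r - i) (schur_vector i))"
    by (simp only: op_scale[symmetric] schur_vector_Suc)
  also have "\<dots> = (\<Sum>i\<le>r. X (Suc r - i) (I k (schur_vector i)))"
    by (simp add: op_sum op_scale op_neg I_I[of k])
  also have "\<dots> = 0" using 2 by simp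
  finally show ?case by (simp del: of_nat_Suc)
qed

text \<open>In each product I(k) I(n - k) the modes add up to n > 0, so one of them is positive and
  can be applied first.\<close>

lemma W_mode_schur_vector:
  assumes "n > 0"
  shows "W_mode scale \<rho> c n (schur_vector r) = 0"
proof -
  have "I k (I (n - k) (schur_vector r)) = 0" for k
  proof (cases "k > 0")
    case True
    then show ?thesis by (subst I_I) (simp add: I_schur_vector)
  next
    case False
    then show ?thesis using assms by (simp add: I_schur_vector)
  qed
  then show ?thesis using assms by (simp add: W_mode_def normal_ordered_II_eq I_schur_vector)
qed

lemma L_X:
  "c\<^sub>L\<^sub>I \<noteq> 0 \<Longrightarrow> L n (X k u) = X k (L n u) - scale (of_nat k / c\<^sub>L\<^sub>I) (I (n - int k) u)
     + (if n = int k then scale (of_int (n\<^sup>2 + n)) u else 0)"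
  by (auto simp: op_scale op_neg L_I scale_right_diff_distrib scale_right_distrib)

lemma L_0_schur_vector:
  assumes c: "c\<^sub>L\<^sub>I \<noteq> 0"
  shows "L 0 (schur_vector r) = scale (h + of_nat r) (schur_vector r)"
proof (induction r rule: nat_Suc_strong_induct)
  case 1
  then show ?case by (simp add: schur_vector_0 L_0_v)
next
  case (2 r)
  have LX: "L 0 (X (Suc r - i) (schur_vector i)) = scale (h + of_nat (Suc r)) (X (Suc r - i) (schur_vector i))"
    if i: "i \<le> r" for i
  proof -
    define k where "k = Suc r - i"
    have k: "k > 0" "Suc r = i + k" using i by (auto simp: k_def)
    have "L 0 (X k (schur_vector i)) = X k (L 0 (schur_vector i)) + scale (of_nat k) (X k (schur_vector i))"
      using L_X[OF c, of 0 k] k by simp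
    also have "\<dots> = scale (h + of_nat i + of_nat k) (X k (schur_vector i))"
      using 2[OF i] by (simp only: X_add X_scale scale_left_distrib)
    also have "h + of_nat i + of_nat k = h + of_nat (Suc r)"
      by (simp only: k(2) of_nat_add add.assoc)
    finally show ?thesis by (simp only: k_def)
  qed
  have "scale (of_nat (Suc r)) (L 0 (schur_vector (Suc r))) = L 0 (\<Sum>i\<le>r. X (Suc r - i) (schur_vector i))"
    by (simp only: op_scale[symmetric] schur_vector_Suc)
  also have "\<dots> = (\<Sum>i\<le>r. scale (h + of_nat (Suc r)) (X (Suc r - i) (schur_vector i)))"
    unfolding op_sum by (intro sum.cong refl LX) simp
  also have "\<dots> = scale (h + of_nat (Suc r)) (scale (of_nat (Suc r)) (schur_vector (Suc r)))"
    by (simp only: scale_sum_right schur_vector_Suc)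
  also have "\<dots> = scale (of_nat (Suc r)) (scale (h + of_nat (Suc r)) (schur_vector (Suc r)))"
    by (rule scale_left_commute)
  finally show ?case by (rule scale_Suc_cancel)
qed

text \<open>After multiplication by r + 1, L(n) is moved past each X in the recursion. The terms
  where it reaches s_i and the commutators with X both resum, by the recursion, to multiples of
  s_(r+1-n).\<close>

lemma L_schur_vector:
  assumes c: "c\<^sub>L\<^sub>I \<noteq> 0" and h\<^sub>I: "h\<^sub>I = (1 + p) * c\<^sub>L\<^sub>I" and n: "n > 0"
  shows "L (int n) (schur_vector r) =
    (if n \<le> r then scale (of_nat r - p) (schur_vector (r - n)) else 0)"
proof (induction r rule: nat_Suc_strong_induct)
  case 1
  then show ?case using n by (simp add: schur_vector_0 L_v)
next
  case (2 r)
  let ?R = "Suc r"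
  \<comment> \<open>\<open>\<tau> i\<close> is L(n) s_i by induction; \<open>T i\<close>, defined
    next, is the commutator of L(n) with X, applied to s_i.\<close>
  define \<tau> where "\<tau> i = (if n \<le> i then scale (of_nat i - p) (schur_vector (i - n)) else 0)" for i
  define T where "T i = (if i + n < ?R then scale (of_nat (?R - i)) (X (?R - n - i) (schur_vector i))
      else if i + n = ?R then scale (of_nat n * (of_nat n - p)) (schur_vector i) else 0)" for i
  have LX: "L (int n) (X (?R - i) (schur_vector i)) = X (?R - i) (\<tau> i) + T i" if i: "i \<le> r" for i
  proof -
    define k where "k = ?R - i"
    have k: "k > 0" "?R = i + k" using i by (auto simp: k_def)
    have comm: "L (int n) (X k (schur_vector i)) = X k (\<tau> i) - scale (of_nat k / c\<^sub>L\<^sub>I) (I (int n - int k) (schur_vector i))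
     + (if n = k then scale (of_int ((int n)\<^sup>2 + int n)) (schur_vector i) else 0)"
      unfolding \<tau>_def using L_X[OF c, of "int n" k "schur_vector i"] 2[OF i] by (simp del: of_int_add of_int_power)
    consider "n < k" | "n = k" | "k < n" by linarith
    then have "- scale (of_nat k / c\<^sub>L\<^sub>I) (I (int n - int k) (schur_vector i))
     + (if n = k then scale (of_int ((int n)\<^sup>2 + int n)) (schur_vector i) else 0) = T i"
    proof cases
      case 1
      then have "int n - int k = - int (k - n)" by simp
      then show ?thesis using 1 k by (simp add: T_def)
    next
      case 2
      \<comment> \<open>The value of h_I enters here: I(0) contributes -n (1 + p), the central term
        n^2 + n, and together they give n (n - p).\<close>
      have "- (of_nat k / c\<^sub>L\<^sub>I) * h\<^sub>I + of_int ((int n)\<^sup>2 + int n) = of_nat n * (of_nat n - p)"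
        using c 2 by (simp add: h\<^sub>I field_simps power2_eq_square)
      moreover have "- scale (of_nat k / c\<^sub>L\<^sub>I) (scale h\<^sub>I (schur_vector i)) + scale (of_int ((int n)\<^sup>2 + int n)) (schur_vector i)
        = scale (- (of_nat k / c\<^sub>L\<^sub>I) * h\<^sub>I + of_int ((int n)\<^sup>2 + int n)) (schur_vector i)"
        by (simp only: scale_left_distrib scale_minus_left scale_scale mult_minus_left)
      ultimately show ?thesis using 2 k by (simp add: T_def I_0 del: of_int_add of_int_power)
    next
      case 3
      then show ?thesis using k by (simp add: T_def I_schur_vector)
    qed
    with comm show ?thesis by (simp add: k_def[symmetric] algebra_simps)
  qed
  have "scale (of_nat ?R) (L (int n) (schur_vector ?R)) = L (int n) (\<Sum>i\<le>r. X (?R - i) (schur_vector i))"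
    by (simp only: op_scale[symmetric] schur_vector_Suc)
  also have "\<dots> = (\<Sum>i\<le>r. X (?R - i) (\<tau> i) + T i)"
    unfolding op_sum by (intro sum.cong refl LX) simp
  also have "\<dots> = (\<Sum>i\<le>r. X (?R - i) (\<tau> i)) + (\<Sum>i\<le>r. T i)"
    by (rule sum.distrib)
  also have "\<dots> = scale (of_nat ?R) (if n \<le> ?R then scale (of_nat ?R - p) (schur_vector (?R - n)) else 0)"
  proof -
    consider "n > ?R" | "n = ?R" | "n \<le> r" by linarith
    then show ?thesis
    proof cases
      case 1
      then show ?thesis by (simp add: \<tau>_def T_def)
    next
      case 2
      \<comment> \<open>Only i = 0 meets the condition i + n = R.\<close>
      have "(\<Sum>i\<le>r. T i) = (\<Sum>i\<in>{0}. T i)"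
        using 2 by (intro sum.mono_neutral_right) (auto simp: T_def)
      then show ?thesis using 2 by (simp add: \<tau>_def T_def)
    next
      case 3
      define q where "q = r - n"
      have r: "r = q + n" using 3 by (simp add: q_def)
      have "(\<Sum>i\<le>r. X (?R - i) (\<tau> i)) = (\<Sum>i\<in>{n..r}. X (?R - i) (\<tau> i))"
        by (intro sum.mono_neutral_right) (auto simp: \<tau>_def)
      \<comment> \<open>The shift i = j + n turns X (R - i) into X (q + 1 - j), the factor in the
        recursion for s_(q+1).\<close>
      also have "\<dots> = (\<Sum>j\<le>q. scale (of_nat (j + n) - p) (X (Suc q - j) (schur_vector j)))"
        by (rule sum.reindex_bij_witness[where i = "\<lambda>j. j + n" and j = "\<lambda>i. i - n"])
          (auto simp: r \<tau>_def op_scale op_neg mult.commute Suc_diff_le)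
      finally have A: "(\<Sum>i\<le>r. X (?R - i) (\<tau> i)) = \<dots>" .
      \<comment> \<open>\<open>T\<close> vanishes beyond i = R - n = q + 1, and this last index
        carries the contribution of I(0) and the central element.\<close>
      have "(\<Sum>i\<le>r. T i) = (\<Sum>i\<le>Suc q. T i)"
        using n by (intro sum.mono_neutral_right) (auto simp: T_def r)
      also have "\<dots> = (\<Sum>j\<le>q. T j) + T (Suc q)" by simp
      also have "T (Suc q) = scale (of_nat n * (of_nat n - p)) (schur_vector (Suc q))"
        by (simp add: T_def r)
      also have "(\<Sum>j\<le>q. T j) = (\<Sum>j\<le>q. scale (of_nat (?R - j)) (X (Suc q - j) (schur_vector j)))"
        by (intro sum.cong) (auto simp: T_def r)
      finally have B: "(\<Sum>i\<le>r. T i) = (\<Sum>j\<le>q. scale (of_nat (?R - j)) (X (Suc q - j) (schur_vector j))) +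
         scale (of_nat n * (of_nat n - p)) (schur_vector (Suc q))" .
      have "(\<Sum>j\<le>q. scale (of_nat (j + n) - p) (X (Suc q - j) (schur_vector j))) +
          (\<Sum>j\<le>q. scale (of_nat (?R - j)) (X (Suc q - j) (schur_vector j))) =
          (\<Sum>j\<le>q. scale (of_nat (?R + n) - p) (X (Suc q - j) (schur_vector j)))"
        unfolding sum.distrib[symmetric] scale_left_distrib[symmetric]
      proof (intro sum.cong refl)
        fix j assume "j \<in> {..q}"
        then have "of_nat (j + n) - p + of_nat (?R - j) = (of_nat (?R + n) - p :: complex)"
          by (simp add: r of_nat_diff)
        then show "scale (of_nat (j + n) - p + of_nat (?R - j)) (X (Suc q - j) (schur_vector j)) =
          scale (of_nat (?R + n) - p) (X (Suc q - j) (schur_vector j))" by (simp only:)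
      qed
      also have "\<dots> = scale (of_nat (?R + n) - p) (scale (of_nat (Suc q)) (schur_vector (Suc q)))"
        by (simp only: scale_sum_right schur_vector_Suc)
      finally have "(\<Sum>i\<le>r. X (?R - i) (\<tau> i)) + (\<Sum>i\<le>r. T i) =
         scale (of_nat (?R + n) - p) (scale (of_nat (Suc q)) (schur_vector (Suc q))) +
         scale (of_nat n * (of_nat n - p)) (schur_vector (Suc q))"
        unfolding A B by (simp only: add.assoc[symmetric])
      also have "\<dots> = scale ((of_nat (?R + n) - p) * of_nat (Suc q) + of_nat n * (of_nat n - p)) (schur_vector (Suc q))"
        by (simp only: scale_scale scale_left_distrib)
      \<comment> \<open>With q + 1 = R - n this is (R + n - p)(R - n) + n (n - p) = R (R -
        p).\<close>
      also have "(of_nat (?R + n) - p) * of_nat (Suc q) + of_nat n * (of_nat n - p) = of_nat ?R * (of_nat ?R - p)"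
        by (simp add: r algebra_simps)
      finally show ?thesis using 3 by (simp add: r)
    qed
  qed
  finally show ?case by (rule scale_Suc_cancel)
qed

text \<open>S_r contains the linear term x_r / r. It is detected by evaluating the functional
  \<open>\<Theta>\<close> of s_r at the one-letter word b_r.\<close>

lemma schur_vector_nonzero:
  assumes c: "c\<^sub>L\<^sub>I \<noteq> 0"
  shows "schur_vector r \<noteq> 0"
proof -
  obtain \<Theta> where \<Theta>: "Vector_Spaces.linear scale fun_scale \<Theta>" "\<Theta> v = counit"
    "\<And>x u. x \<in> hv_neg \<Longrightarrow> \<Theta> (\<rho> x u) = coder x (\<Theta> u)"
    using hv_free_lift[OF lie free] by blast
  interpret \<Theta>: Vector_Spaces.linear scale fun_scale \<Theta> by fact
  show ?thesis
  proof (cases r)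
    case 0
    have "\<Theta> v [] \<noteq> 0" by (simp add: \<Theta>(2) counit_def)
    then show ?thesis using 0 \<Theta>.zero by (auto simp: schur_vector_0)
  next
    case (Suc r)
    have X: "\<Theta> (X k u) M = (- 1 / c\<^sub>L\<^sub>I) * coder (IH (- int k)) (\<Theta> u) M" if "k > 0" for k u M
      using that by (simp add: \<Theta>.neg \<Theta>.scale \<Theta>(3) mem_hv_neg_iff fun_scale_def)
    have sum_apply: "(\<Sum>i\<in>A. \<phi> i) M = (\<Sum>i\<in>A. \<phi> i M)"
      for A :: "nat set" and \<phi> :: "nat \<Rightarrow> hv_basis list \<Rightarrow> complex" and M
      by (induction A rule: infinite_finite_induct) auto
    have "of_nat (Suc r) * \<Theta> (schur_vector (Suc r)) [IH (- int (Suc r))] =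
        \<Theta> (scale (of_nat (Suc r)) (schur_vector (Suc r))) [IH (- int (Suc r))]"
      by (simp only: \<Theta>.scale fun_scale_def)
    also have "\<dots> = (\<Sum>i\<le>r. \<Theta> (X (Suc r - i) (schur_vector i)) [IH (- int (Suc r))])"
      by (simp only: schur_vector_Suc \<Theta>.sum sum_apply)
    \<comment> \<open>The derivative by b_(R-i) kills the single letter b_R unless i = 0, where the
      constant term of the counit remains.\<close>
    also have "\<dots> = (\<Sum>i\<le>r. if i = 0 then - 1 / c\<^sub>L\<^sub>I else 0)"
      by (intro sum.cong refl, subst X) (auto simp: schur_vector_0 \<Theta>(2) counit_def)
    also have "\<dots> \<noteq> 0" using c by simp
    finally show ?thesis using Suc \<Theta>.zero by auto
  qed
qed

end

theorem theorem7p5: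
  fixes scaleW :: "complex \<Rightarrow> 'w \<Rightarrow> 'w::ab_group_add"
    and actW :: "w22_basis \<Rightarrow> 'w \<Rightarrow> 'w"
    and vW :: 'w
    and scaleH :: "complex \<Rightarrow> 'v \<Rightarrow> 'v::ab_group_add"
    and actH :: "hv_basis \<Rightarrow> 'v \<Rightarrow> 'v"
    and vH :: 'v
    and \<Psi> :: "'w \<Rightarrow> 'v"
    and c\<^sub>L h h\<^sub>W c\<^sub>W h\<^sub>I c\<^sub>L\<^sub>I :: complex
    and p :: nat
  assumes "c\<^sub>W \<noteq> 0"
    and "p > 0"
    and "h\<^sub>W / c\<^sub>W = (1 - of_nat p ^ 2) / 24"
    and "c\<^sub>W = - 24 * c\<^sub>L\<^sub>I ^ 2"
    and "h\<^sub>W = h\<^sub>I * (h\<^sub>I - 2 * c\<^sub>L\<^sub>I)"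
    and "h\<^sub>I / c\<^sub>L\<^sub>I - 1 = of_nat p"
    and "w22_verma scaleW actW vW c\<^sub>L c\<^sub>W h h\<^sub>W"
    and "hv_verma scaleH actH vH c\<^sub>L 0 c\<^sub>L\<^sub>I h h\<^sub>I"
    and "lie_module_hom scaleW scaleH actW (w22_act_on_hv scaleH actH c\<^sub>L c\<^sub>W c\<^sub>L\<^sub>I) \<Psi>"
    and "\<Psi> vW = vH"
  shows "bij \<Psi> \<and>
    w22_singular_vector scaleW actW h p
      (inv \<Psi> (poly_act scaleH (\<lambda>n u. scaleH (- 1 / c\<^sub>L\<^sub>I) (actH (IH (- int n)) u)) (schur_poly p) vH))"
proof -
  interpret H: hv_verma_module scaleH actH vH c\<^sub>L c\<^sub>L\<^sub>I h h\<^sub>I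
    using assms by unfold_locales
  have c: "c\<^sub>L\<^sub>I \<noteq> 0" using assms by auto
  have h\<^sub>I: "h\<^sub>I = (1 + of_nat p) * c\<^sub>L\<^sub>I" using assms(6) c by (simp add: field_simps)
  have nonzero: "2 * h\<^sub>I + 2 * c\<^sub>L\<^sub>I * of_int (n - 1) \<noteq> 0" if "n \<ge> 1" for n
  proof -
    have "2 * h\<^sub>I + 2 * c\<^sub>L\<^sub>I * of_int (n - 1) = 2 * c\<^sub>L\<^sub>I * of_int (int p + n)"
      by (simp add: h\<^sub>I algebra_simps)
    moreover have "int p + n \<noteq> 0" using that by linarith
    then have "(of_int (int p + n) :: complex) \<noteq> 0" by (simp only: of_int_eq_0_iff not_False_eq_True)
    ultimately show ?thesis using c by (simp del: of_int_add)
  qed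
  have bij: "bij \<Psi>" by (rule H.bij_w22_hom[OF assms(7,9,10) nonzero])
  define s where "s = H.schur_vector p"
  interpret \<Psi>: Vector_Spaces.linear scaleW scaleH \<Psi>
    using assms(9) by (simp add: lie_module_hom_def)
  have act: "\<Psi> (actW x u) = w22_act_on_hv scaleH actH c\<^sub>L c\<^sub>W c\<^sub>L\<^sub>I x (\<Psi> u)" for x u
    using assms(9) by (simp add: lie_module_hom_def)
  have inv: "\<Psi> (inv \<Psi> s) = s" using bij by (simp add: bij_is_surj surj_f_inv_f)
  have eqI: "u = w" if "\<Psi> u = \<Psi> w" for u w using bij that by (simp add: bij_is_inj inj_eq)
  have "w22_singular_vector scaleW actW h p (inv \<Psi> s)"
    unfolding w22_singular_vector_def
  proof (intro conjI allI impI)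
    show "inv \<Psi> s \<noteq> 0"
      using H.schur_vector_nonzero[OF c, of p] inv \<Psi>.zero by (auto simp: s_def)
    show "actW (LW 0) (inv \<Psi> s) = scaleW (h + of_nat p) (inv \<Psi> s)"
      by (rule eqI) (simp add: act inv \<Psi>.scale H.L_0_schur_vector[OF c, of p, folded s_def])
    fix n :: int assume n: "n > 0"
    \<comment> \<open>For n \<le> p the factor r - p is zero at r = p; for n > p the vector is
      already zero.\<close>
    show "actW (LW n) (inv \<Psi> s) = 0"
      using H.L_schur_vector[OF c h\<^sub>I, of "nat n" p, folded s_def] n
      by (intro eqI) (simp add: act inv \<Psi>.zero)
    show "actW (WW n) (inv \<Psi> s) = 0"
      by (rule eqI) (simp add: act inv \<Psi>.zero H.W_mode_schur_vector[OF n, of _ p, folded s_def])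
  qed
  with bij show ?thesis by (simp only: s_def H.schur_vector_def simp_thms)
qed

end
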